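(* Let $(X,\varphi)$ be a bounded $N$-dimensional Lattice EDS with $N=1$ or $N=2$, and assume $X$ is compact. Then: (i) $(X,\varphi)$ has no periodic orbits of period $T>0$; that is, there is no non-stationary $u\in X$ with $\varphi(u,T)=u$ for some $T>0$. (ii) The $\omega$-limit set of each $u\in X$ contains an equilibrium. (iii) The only uniformly recurrent points of $\varphi$ are equilibria. (iv) The only minimal, closed positively invariant sets consist of single equilibria. (v) All $\varphi$-invariant Borel probability measures on $X$ are supported on the set of equilibria.
   Context: Notation: $\varepsilon_1,\dots,\varepsilon_N$ is the standard basis of $\mathbb{Z}^N$; for $v:\mathbb{Z}^N\to\mathbb{R}^N$, $\operatorname{div} v(\alpha)=\sum_{j=1}^N \big(v_j(\alpha)-v_j(\alpha-\varepsilon_j)\big)$; $l_\infty(\mathbb{Z}^N)$ is the space of bounded functions $\mathbb{Z}^N\to\mathbb{R}$ with sup-norm $\|\cdot\|_\infty$; $\mathbb{R}^+=[0,\infty)$. Definition (Lattice EDS). Let $X$ be a metrizable space and $\varphi$ a continuous semiflow on $X$; write $u(t)=\varphi(u,t)$, $t\ge 0$. A point $u\in X$ is stationary (an equilibrium) if $\varphi(u,t)=u$ for all $t\ge 0$. $(X,\varphi)$ is an $N$-dimensional extended dissipative system on a lattice (Lattice EDS) if there are functions $e,d,f_1,\dots,f_N:X\to l_\infty(\mathbb{Z}^N)$ (energy, dissipation, flux $f=(f_1,\dots,f_N)$), written $u\mapsto e_u,d_u,f_u$, such that: (A1) $e_u(\alpha)\ge 0$, $d_u(\alpha)\geq 0$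 for all $u\in X$, $\alpha\in\mathbb{Z}^N$. (A2) For each $\alpha$, the maps $u\mapsto e_u(\alpha),d_u(\alpha),(f_1)_u(\alpha),\dots,(f_N)_u(\alpha)$ are continuous $X\to\mathbb{R}$; and for each $u\in X$ the maps $t\mapsto\|e_{u(t)}\|_\infty,\|d_{u(t)}\|_\infty,\|f_{u(t)}\|_\infty$ are continuous $\mathbb{R}^+\to\mathbb{R}^+$. (A3) If $d_u\equiv 0$ then $u$ is stationary. (A4) Along each semiorbit $u(t)$ and at each $\alpha$, $\partial_t e_{u(t)}(\alpha)=-d_{u(t)}(\alpha)+\operatorname{div} f_{u(t)}(\alpha)$, with $\partial_t$ in the sense of distributions. (A5) There is a non-decreasing $b:\mathbb{R}^+\to\mathbb{R}^+$ such that $|f_u(\alpha)|^2\le b(\|e_u\|_\infty)\, d_u(\alpha)$ for all $u\in X$, $\alpha\in\mathbb{Z}^N$. The Lattice EDS is bounded if $\sup_{u\in X}\|e_u\|_\infty<\infty$. The $\omega$-limit set $\omega(u)$ is the set of limit points of $u(t)$ as $t\to\infty$. A point $x\in X$ is uniformly recurrent if for each open neighbourhood $U$ of $x$ there exist $n\ge1$ and $t_1,\dots,t_n\ge 0$ such that for every $t\ge 0$ there is $k\in\{1,\dots,n\}$ with $\varphi(x,t+t_k)\in U$. A minimal closed positively invariant set is a non-empty closed set $A$ with $\varphi(A,t)\subset A$ for all $t\ge 0$ having no proper non-empty closed positively invariant subset. A measure $\mu$ is supported on a set $\mathcal{E}$ of equilibria if $\mu(\mathcal{E})=1$. *)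

theory Defs
  imports "HOL-Analysis.Analysis" "HOL-Probability.Probability_Measure"
begin

section \<open>Bounded functions on the lattice\<close>

text \<open>
  The lattice \<open>\<int>\<^sup>N\<close> is \<^typ>\<open>int ^ 'n\<close> with \<open>N = CARD('n)\<close>, and \<^term>\<open>axis j 1\<close> is its
  \<open>j\<close>-th standard basis vector. Vectors in \<open>\<real>\<^sup>N\<close> carry the Euclidean norm, so for vector-valued
  functions \<open>linf_norm\<close> is the supremum of the pointwise Euclidean norms.
\<close>

definition linf :: "(int ^ 'n::finite \<Rightarrow> 'b::real_normed_vector) set" where
  "linf = {g. bounded (range g)}"

definition linf_norm :: "(int ^ 'n::finite \<Rightarrow> 'b::real_normed_vector) \<Rightarrow> real" where
  "linf_norm g = (SUP \<alpha>. norm (g \<alpha>))"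

definition lattice_div :: "(int ^ 'n::finite \<Rightarrow> real ^ 'n) \<Rightarrow> int ^ 'n \<Rightarrow> real" where
  "lattice_div v \<alpha> = (\<Sum>j\<in>UNIV. v \<alpha> $ j - v (\<alpha> - axis j 1) $ j)"

section \<open>Distributional derivatives\<close>

definition test_function_on :: "real set \<Rightarrow> (real \<Rightarrow> real) \<Rightarrow> bool" where
  "test_function_on S \<psi> \<longleftrightarrow>
     (\<forall>k t. (deriv ^^ k) \<psi> differentiable (at t)) \<and>
     (\<exists>K. compact K \<and> K \<subseteq> S \<and> (\<forall>t. t \<notin> K \<longrightarrow> \<psi> t = 0))"

definition locally_integrable_on :: "real set \<Rightarrow> (real \<Rightarrow> real) \<Rightarrow> bool" where
  "locally_integrable_on S g \<longleftrightarrow> (\<forall>K. compact K \<and> K \<subseteq> S \<longrightarrow> set_integrable lborel K g)"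

definition has_distributional_deriv_on ::
    "(real \<Rightarrow> real) \<Rightarrow> (real \<Rightarrow> real) \<Rightarrow> real set \<Rightarrow> bool" where
  "has_distributional_deriv_on g h S \<longleftrightarrow>
     locally_integrable_on S g \<and> locally_integrable_on S h \<and>
     (\<forall>\<psi>. test_function_on S \<psi> \<longrightarrow>
        (LINT t:S|lborel. h t * \<psi> t) = - (LINT t:S|lborel. g t * deriv \<psi> t))"

section \<open>Semiflows\<close>

text \<open>Only the values of \<open>\<phi> u t\<close> with \<open>u \<in> topspace X\<close> and \<open>t \<ge> 0\<close> are relevant.\<close>

locale semiflow =
  fixes X :: "'a topology" and \<phi> :: "'a \<Rightarrow> real \<Rightarrow> 'a"
  assumes continuous_flow:
      "continuous_map (prod_topology X (top_of_set {0..})) X (\<lambda>(u, t). \<phi> u t)"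
    and flow_zero: "\<And>u. u \<in> topspace X \<Longrightarrow> \<phi> u 0 = u"
    and flow_add: "\<And>u s t. u \<in> topspace X \<Longrightarrow> s \<ge> 0 \<Longrightarrow> t \<ge> 0 \<Longrightarrow> \<phi> u (s + t) = \<phi> (\<phi> u s) t"

definition equilibria :: "'a topology \<Rightarrow> ('a \<Rightarrow> real \<Rightarrow> 'a) \<Rightarrow> 'a set" where
  "equilibria X \<phi> = {u \<in> topspace X. \<forall>t\<ge>0. \<phi> u t = u}"

definition omega_limit :: "'a topology \<Rightarrow> ('a \<Rightarrow> real \<Rightarrow> 'a) \<Rightarrow> 'a \<Rightarrow> 'a set" where
  "omega_limit X \<phi> u =
     {x. \<exists>s :: nat \<Rightarrow> real. (\<forall>n. s n \<ge> 0) \<and> filterlim s at_top sequentially \<and>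
           limitin X (\<lambda>n. \<phi> u (s n)) x sequentially}"

definition uniformly_recurrent :: "'a topology \<Rightarrow> ('a \<Rightarrow> real \<Rightarrow> 'a) \<Rightarrow> 'a \<Rightarrow> bool" where
  "uniformly_recurrent X \<phi> x \<longleftrightarrow>
     x \<in> topspace X \<and>
     (\<forall>U. openin X U \<and> x \<in> U \<longrightarrow>
        (\<exists>n\<ge>1. \<exists>\<tau> :: nat \<Rightarrow> real. (\<forall>k\<in>{1..n}. \<tau> k \<ge> 0) \<and>
           (\<forall>t\<ge>0. \<exists>k\<in>{1..n}. \<phi> x (t + \<tau> k) \<in> U)))"

definition closed_positively_invariant ::
    "'a topology \<Rightarrow> ('a \<Rightarrow> real \<Rightarrow> 'a) \<Rightarrow> 'a set \<Rightarrow> bool" where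
  "closed_positively_invariant X \<phi> A \<longleftrightarrow>
     closedin X A \<and> (\<forall>t\<ge>0. (\<lambda>u. \<phi> u t) ` A \<subseteq> A)"

definition minimal_closed_positively_invariant ::
    "'a topology \<Rightarrow> ('a \<Rightarrow> real \<Rightarrow> 'a) \<Rightarrow> 'a set \<Rightarrow> bool" where
  "minimal_closed_positively_invariant X \<phi> A \<longleftrightarrow>
     A \<noteq> {} \<and> closed_positively_invariant X \<phi> A \<and>
     \<not> (\<exists>B. B \<noteq> {} \<and> B \<subset> A \<and> closed_positively_invariant X \<phi> B)"

definition invariant_borel_prob ::
    "'a topology \<Rightarrow> ('a \<Rightarrow> real \<Rightarrow> 'a) \<Rightarrow> 'a measure \<Rightarrow> bool" where
  "invariant_borel_prob X \<phi> \<mu> \<longleftrightarrow>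
     space \<mu> = topspace X \<and>
     sets \<mu> = sigma_sets (topspace X) {U. openin X U} \<and>
     prob_space \<mu> \<and>
     (\<forall>t\<ge>0. \<forall>A\<in>sets \<mu>. emeasure \<mu> {u \<in> topspace X. \<phi> u t \<in> A} = emeasure \<mu> A)"

section \<open>Extended dissipative systems on a lattice\<close>

text \<open>
  The time derivative in \<open>energy_balance\<close> is taken in the sense of distributions on the open
  half-line; by \<open>continuous_energy\<close> the energy at each site is continuous up to time \<open>0\<close>.
\<close>

locale lattice_EDS = semiflow X \<phi>
  for X :: "'a topology" and \<phi> :: "'a \<Rightarrow> real \<Rightarrow> 'a" +
  fixes e :: "'a \<Rightarrow> int ^ 'n::finite \<Rightarrow> real"
    and d :: "'a \<Rightarrow> int ^ 'n \<Rightarrow> real"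
    and f :: "'a \<Rightarrow> int ^ 'n \<Rightarrow> real ^ 'n"
  assumes metrizable: "metrizable_space X"
    and energy_linf: "\<And>u. u \<in> topspace X \<Longrightarrow> e u \<in> linf"
    and dissipation_linf: "\<And>u. u \<in> topspace X \<Longrightarrow> d u \<in> linf"
    and flux_linf: "\<And>u j. u \<in> topspace X \<Longrightarrow> (\<lambda>\<alpha>. f u \<alpha> $ j) \<in> linf"
    and energy_nonneg: "\<And>u \<alpha>. u \<in> topspace X \<Longrightarrow> e u \<alpha> \<ge> 0"
    and dissipation_nonneg: "\<And>u \<alpha>. u \<in> topspace X \<Longrightarrow> d u \<alpha> \<ge> 0"
    and continuous_energy: "\<And>\<alpha>. continuous_map X euclideanreal (\<lambda>u. e u \<alpha>)"
    and continuous_dissipation: "\<And>\<alpha>. continuous_map X euclideanreal (\<lambda>u. d u \<alpha>)"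
    and continuous_flux: "\<And>\<alpha> j. continuous_map X euclideanreal (\<lambda>u. f u \<alpha> $ j)"
    and continuous_energy_norm:
      "\<And>u. u \<in> topspace X \<Longrightarrow> continuous_on {0..} (\<lambda>t. linf_norm (e (\<phi> u t)))"
    and continuous_dissipation_norm:
      "\<And>u. u \<in> topspace X \<Longrightarrow> continuous_on {0..} (\<lambda>t. linf_norm (d (\<phi> u t)))"
    and continuous_flux_norm:
      "\<And>u. u \<in> topspace X \<Longrightarrow> continuous_on {0..} (\<lambda>t. linf_norm (f (\<phi> u t)))"
    and stationary_if_no_dissipation:
      "\<And>u. u \<in> topspace X \<Longrightarrow> (\<forall>\<alpha>. d u \<alpha> = 0) \<Longrightarrow> u \<in> equilibria X \<phi>"
    and energy_balance:
      "\<And>u \<alpha>. u \<in> topspace X \<Longrightarrow>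
         has_distributional_deriv_on (\<lambda>t. e (\<phi> u t) \<alpha>)
           (\<lambda>t. - d (\<phi> u t) \<alpha> + lattice_div (f (\<phi> u t)) \<alpha>) {0<..}"
    and flux_bound:
      "\<exists>b :: real \<Rightarrow> real. mono_on {0..} b \<and> (\<forall>r\<ge>0. b r \<ge> 0) \<and>
         (\<forall>u\<in>topspace X. \<forall>\<alpha>. (norm (f u \<alpha>))\<^sup>2 \<le> b (linf_norm (e u)) * d u \<alpha>)"

locale bounded_lattice_EDS = lattice_EDS X \<phi> e d f
  for X :: "'a topology" and \<phi> :: "'a \<Rightarrow> real \<Rightarrow> 'a"
    and e :: "'a \<Rightarrow> int ^ 'n::finite \<Rightarrow> real"
    and d :: "'a \<Rightarrow> int ^ 'n \<Rightarrow> real"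
    and f :: "'a \<Rightarrow> int ^ 'n \<Rightarrow> real ^ 'n" +
  assumes energy_bounded: "bdd_above ((\<lambda>u. linf_norm (e u)) ` topspace X)"

end

theory Submission
  imports Defs "HOL-Complex_Analysis.Great_Picard"
begin

text \<open>
  Averaging the energy balance along an orbit over \<open>[0, T]\<close> gives a stationary balance
  \<open>D = div F + O(1/T)\<close> with \<open>F\<^sub>j\<^sup>2 \<le> B D\<close>. Let \<open>S n\<close> be the sum of \<open>D\<close> over the box of
  radius \<open>n\<close>. Only the flux through the boundary of the box survives, and by Cauchy-Schwarz
  \<open>S (n+1) \<le> K \<surd>((n+1) (S (n+2) - S n)) + O(n\<^sup>2/T)\<close>, since for \<open>N \<le> 2\<close> a boundary shell has
  at most of order \<open>n\<close> points. The dissipation need not be bounded uniformly over \<open>X\<close>, but for each fixed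
  orbit and \<open>T\<close> it is bounded, and the recursion upgrades this to a bound on \<open>S n\<close> independent
  of the orbit that becomes linear in \<open>n\<close> as \<open>T \<rightarrow> \<infinity>\<close>. A limit of \<open>S\<close> as \<open>T \<rightarrow> \<infinity>\<close> then satisfies
  a discrete Riccati inequality whose only solution is zero, because the harmonic series diverges.
  Hence the time averages of the dissipation at each site tend to zero along every orbit.

  It follows that at suitable late times the dissipation is small on large boxes, so
  \<open>\<omega>\<close>-limit sets contain equilibria; this settles periodic orbits, uniformly recurrent points and
  minimal sets. For an invariant measure, Fubini identifies the integral of the dissipation at a
  site with the integral of its time averages, which tends to zero by dominated convergence.
\<close>

section \<open>Distributional derivatives of continuous functions\<close>

lemma iterated_deriv_differentiable:
  assumes "\<And>f x. f \<in> P \<Longrightarrow> f differentiable (at x)" "\<And>f. f \<in> P \<Longrightarrow> deriv f \<in> P" "f \<in> P"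
  shows "(deriv ^^ k) f differentiable (at (t::real))"
proof -
  have "(deriv ^^ k) f \<in> P"
    by (induction k) (use assms in auto)
  then show ?thesis using assms by blast
qed

text \<open>The polynomial numerator and the power in the denominator make the family closed under
  differentiation; \<open>bump 1 0\<close> is the standard smooth bump on (0, 1), and the parameters
  accommodate its derivatives.\<close>

definition bump :: "real poly \<Rightarrow> nat \<Rightarrow> real \<Rightarrow> real" where
  "bump p k x = (if 0 < x \<and> x < 1 then poly p x / (x * (1 - x)) ^ k * exp (- 1 / (x * (1 - x))) else 0)"

text \<open>Comes from \<open>(1 + z / n) ^ n \<le> exp z\<close> with \<open>z = 1 / y\<close>,
  after dropping the 1 and inverting.\<close>

lemma exp_neg_inverse_le:
  fixes y :: real
  assumes "y > 0" "n > 0"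
  shows "exp (- 1 / y) \<le> real n ^ n * y ^ n"
proof -
  have "(1 / (n * y)) ^ n \<le> (1 + (1 / y) / n) ^ n"
    using assms by (intro power_mono) (auto simp: field_simps)
  also have "\<dots> \<le> exp (1 / y)"
    using assms by (intro exp_ge_one_plus_x_over_n_power_n) (auto intro: order_trans[of _ 0])
  finally have "1 / exp (1 / y) \<le> 1 / (1 / (n * y)) ^ n"
    using assms by (intro divide_left_mono) auto
  then show ?thesis
    using assms by (simp add: exp_minus power_divide power_mult_distrib field_simps)
qed

text \<open>The exponential beats every power of x (1 - x): the exponent \<open>k + 2\<close>
  cancels the denominator and leaves a square, which forces derivative 0 at the endpoints.\<close>

lemma bump_le:
  obtains M where "M \<ge> 0" "\<And>x. \<bar>bump p k x\<bar> \<le> M * (x * (1 - x))\<^sup>2"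
proof -
  have "compact ((\<lambda>x. poly p x) ` {0..1})"
    by (intro compact_continuous_image continuous_intros) auto
  then have "\<exists>C. \<forall>x\<in>{0..1}. \<bar>poly p x\<bar> \<le> C"
    by (auto simp: bounded_iff dest!: compact_imp_bounded)
  then obtain C where C: "\<And>x. 0 \<le> x \<Longrightarrow> x \<le> 1 \<Longrightarrow> \<bar>poly p x\<bar> \<le> C"
    by (metis atLeastAtMost_iff)
  have C0: "C \<ge> 0" using C[of 0] by auto
  show ?thesis
  proof (rule that[of "C * real (k + 2) ^ (k + 2)"])
    fix x :: real
    show "\<bar>bump p k x\<bar> \<le> C * real (k + 2) ^ (k + 2) * (x * (1 - x))\<^sup>2"
    proof (cases "0 < x \<and> x < 1")
      case True
      define y where "y = x * (1 - x)"
      have y: "y > 0" using True by (simp add: y_def)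
      have "\<bar>bump p k x\<bar> = \<bar>poly p x\<bar> * (exp (- 1 / y) / y ^ k)"
        using True y by (simp add: bump_def y_def abs_mult)
      also have "\<dots> \<le> C * ((real (k + 2) ^ (k + 2) * y ^ (k + 2)) / y ^ k)"
        using True y C0 by (intro mult_mono divide_right_mono exp_neg_inverse_le C) auto
      also have "\<dots> = C * real (k + 2) ^ (k + 2) * y\<^sup>2"
        using y by (simp only: power_add) simp
      finally show ?thesis by (simp add: y_def)
    qed (use C0 in \<open>auto simp: bump_def\<close>)
  qed (use C0 in simp)
qed

lemma has_real_derivative_zero_quadratic:
  fixes f :: "real \<Rightarrow> real"
  assumes "\<And>y. \<bar>f y - f x\<bar> \<le> M * (y - x)\<^sup>2"
  shows "(f has_real_derivative 0) (at x)"
proof -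
  have "((\<lambda>h. (f (x + h) - f x) / h) \<longlongrightarrow> 0) (at 0)"
  proof (rule Lim_null_comparison)
    show "\<forall>\<^sub>F h in at 0. norm ((f (x + h) - f x) / h) \<le> M * \<bar>h\<bar>"
      unfolding eventually_at_filter
    proof (intro always_eventually allI impI)
      fix h :: real assume "h \<noteq> 0"
      then show "norm ((f (x + h) - f x) / h) \<le> M * \<bar>h\<bar>"
        using assms[of "x + h"] by (simp add: field_simps power2_eq_square abs_mult)
    qed
    show "((\<lambda>h. M * \<bar>h\<bar>) \<longlongrightarrow> 0) (at 0)"
      by (auto intro!: tendsto_eq_intros)
  qed
  then show ?thesis by (simp add: DERIV_def)
qed

text \<open>Inside (0, 1) this is the product rule over a common denominator; elsewhere the function
  vanishes and the quadratic bound makes its derivative 0.\<close>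

lemma bump_has_derivative:
  "\<exists>p'. \<forall>x. (bump p k has_real_derivative bump p' (k + 2) x) (at x)"
proof -
  define q :: "real poly" where "q = [:0, 1, - 1:]"
  \<comment> \<open>With q = x (1 - x), this is the numerator over \<open>q ^ (k + 2)\<close> in the
    derivative of \<open>p / q ^ k * exp (- 1 / q)\<close>.\<close>
  define p' where "p' = pderiv p * q\<^sup>2 - of_nat k * p * pderiv q * q + p * pderiv q"
  have "(bump p k has_real_derivative bump p' (k + 2) x) (at x)" for x
  proof (cases "0 < x \<and> x < 1")
    case True
    define y where "y = x * (1 - x)"
    have y: "y > 0" using True by (simp add: y_def)
    have qx: "poly q x = y" "poly (pderiv q) x = 1 - 2 * x"
      by (auto simp: q_def y_def pderiv_pCons algebra_simps)
    have Dy: "((\<lambda>x. x * (1 - x)) has_real_derivative 1 - 2 * x) (at x)"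
      by (auto intro!: derivative_eq_intros)
    have D1: "((\<lambda>x. inverse ((x * (1 - x)) ^ k)) has_real_derivative
        - (of_nat k * (1 - 2 * x) / y) / y ^ k) (at x)"
    proof -
      have "((\<lambda>x. inverse ((x * (1 - x)) ^ k)) has_real_derivative
          - (inverse ((x * (1 - x)) ^ k) * (of_nat k * ((1 - 2 * x) * (x * (1 - x)) ^ (k - Suc 0))) *
            inverse ((x * (1 - x)) ^ k))) (at x)"
        by (rule DERIV_inverse'[OF DERIV_power[OF Dy]]) (use True in simp)
      moreover have "- (inverse (y ^ k) * (of_nat k * ((1 - 2 * x) * y ^ (k - Suc 0))) * inverse (y ^ k)) =
          - (of_nat k * (1 - 2 * x) / y) / y ^ k"
        using y by (cases k) (simp_all add: field_simps)
      ultimately show ?thesis by (simp only: y_def)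
    qed
    have D2: "((\<lambda>x. exp (- 1 / (x * (1 - x)))) has_real_derivative
        exp (- 1 / y) * ((1 - 2 * x) / y\<^sup>2)) (at x)"
      using y by (auto intro!: derivative_eq_intros Dy simp: power2_eq_square simp flip: y_def)
        (simp add: right_diff_distrib diff_divide_distrib)
    have "((\<lambda>x. poly p x * inverse ((x * (1 - x)) ^ k) * exp (- 1 / (x * (1 - x)))) has_real_derivative
        bump p' (k + 2) x) (at x)"
      by (rule DERIV_cong[OF DERIV_mult[OF DERIV_mult[OF poly_DERIV D1] D2]])
        (use True y in \<open>simp add: bump_def p'_def qx field_simps power2_eq_square flip: y_def\<close>)
    then have D: "((\<lambda>x. poly p x / (x * (1 - x)) ^ k * exp (- 1 / (x * (1 - x)))) has_real_derivative
        bump p' (k + 2) x) (at x)"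
      by (simp add: divide_inverse)
    have "\<forall>\<^sub>F z in nhds x. z \<in> {0<..<1}"
      using True by (intro eventually_nhds_in_open) auto
    then have "\<forall>\<^sub>F z in nhds x. bump p k z = poly p z / (z * (1 - z)) ^ k * exp (- 1 / (z * (1 - z)))"
      by eventually_elim (auto simp: bump_def)
    then show ?thesis
      using D by (subst DERIV_cong_ev[OF refl _ refl]) auto
  next
    case False
    obtain M where M: "M \<ge> 0" "\<And>x. \<bar>bump p k x\<bar> \<le> M * (x * (1 - x))\<^sup>2"
      using bump_le[of p k] by metis
    have "\<bar>bump p k y - bump p k x\<bar> \<le> M * (y - x)\<^sup>2" for y
    proof (cases "0 < y \<and> y < 1")
      case True
      \<comment> \<open>As x lies outside (0, 1) and y inside, their distance is at least the
        smaller of y and 1 - y.\<close>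
      have "\<bar>y * (1 - y)\<bar> \<le> \<bar>y - x\<bar>"
      proof -
        have "y * (1 - y) \<le> y" "y * (1 - y) \<le> 1 - y" "0 \<le> y * (1 - y)"
          using True zero_le_square[of "1 - y"] by (auto simp: algebra_simps)
        then show ?thesis using False True by linarith
      qed
      then have "(y * (1 - y))\<^sup>2 \<le> (y - x)\<^sup>2"
        by (simp only: abs_le_square_iff)
      then have "M * (y * (1 - y))\<^sup>2 \<le> M * (y - x)\<^sup>2"
        using M(1) by (rule mult_left_mono)
      moreover have "bump p k x = 0" using False by (auto simp: bump_def)
      ultimately show ?thesis using M(2)[of y] by auto
    qed (use False M in \<open>auto simp: bump_def\<close>)
    then have "(bump p k has_real_derivative 0) (at x)"
      by (rule has_real_derivative_zero_quadratic)
    then show ?thesis using False by (auto simp: bump_def)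
  qed
  then show ?thesis by blast
qed

text \<open>Starting at -1 rather than 0 changes no value, since the bump vanishes up to 0, but
  makes 0 an interior point for the fundamental theorem. The height \<open>bump_step 1\<close> is
  left unnormalised.\<close>

definition bump_step :: "real \<Rightarrow> real" where
  "bump_step x = integral {-1..x} (bump 1 0)"

lemma continuous_bump [continuous_intros]: "continuous_on A (bump p k)"
  using bump_has_derivative[of p k] by (meson DERIV_isCont continuous_at_imp_continuous_on)

lemma bump_eq_0: "x \<le> 0 \<or> x \<ge> 1 \<Longrightarrow> bump p k x = 0"
  by (auto simp: bump_def)

lemma bump_1_pos: "0 < x \<Longrightarrow> x < 1 \<Longrightarrow> bump 1 0 x > 0"
  by (simp add: bump_def)

lemma bump_1_nonneg: "bump 1 0 x \<ge> 0"
  by (simp add: bump_def)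

lemma bump_step_eq_0: "x \<le> 0 \<Longrightarrow> bump_step x = 0"
  unfolding bump_step_def by (subst integral_cong[where g="\<lambda>_. 0"]) (auto simp: bump_eq_0)

lemma bump_step_has_derivative:
  "(bump_step has_real_derivative bump 1 0 x) (at x)"
proof (cases "x > -1")
  case True
  have "(bump_step has_real_derivative bump 1 0 x) (at x within {-1..x+1})"
    unfolding bump_step_def using True
    by (intro integral_has_real_derivative continuous_intros) auto
  then show ?thesis using True by (subst (asm) at_within_Icc_at) auto
next
  case False
  have "\<forall>\<^sub>F z in nhds x. z \<in> {..<0}"
    using False by (intro eventually_nhds_in_open) auto
  then have "\<forall>\<^sub>F z in nhds x. bump_step z = 0"
    by eventually_elim (auto simp: bump_step_eq_0)
  then show ?thesis
    using False by (subst DERIV_cong_ev[OF refl _ refl]) (auto simp: bump_eq_0)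
qed

lemma continuous_bump_step: "continuous_on A bump_step"
  using bump_step_has_derivative by (meson DERIV_isCont continuous_at_imp_continuous_on)

lemma bump_step_ge_1:
  assumes "x \<ge> 1"
  shows "bump_step x = bump_step 1"
proof (cases "x = 1")
  case False
  have "(bump_step has_real_derivative 0) (at y)" if "1 < y" "y < x" for y
    using bump_step_has_derivative[of y] that by (simp add: bump_eq_0)
  then show ?thesis
    using False assms by (intro DERIV_isconst_end[OF _ continuous_bump_step]) auto
qed simp

lemma bump_step_1_pos: "bump_step 1 > 0"
proof -
  have "bump_step 0 < bump_step 1"
    by (rule DERIV_pos_imp_increasing_open[OF _ _ continuous_bump_step])
      (use bump_step_has_derivative bump_1_pos in auto)
  then show ?thesis by (simp add: bump_step_eq_0)
qed

text \<open>
  Its derivative is a bump just to the right of \<open>a\<close> minus one just to the right of \<open>b\<close>, so that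
  testing against it compares the values at \<open>a\<close> and \<open>b\<close> as \<open>r \<rightarrow> 0\<close>.
\<close>
definition plateau :: "real \<Rightarrow> real \<Rightarrow> real \<Rightarrow> real \<Rightarrow> real" where
  "plateau a b r t = bump_step ((t - a) / r) - bump_step ((t - b) / r)"

lemma plateau_has_derivative:
  assumes "r > 0"
  shows "(plateau a b r has_real_derivative bump 1 0 ((t - a) / r) / r - bump 1 0 ((t - b) / r) / r) (at t)"
proof -
  have "((\<lambda>t. bump_step ((t - c) / r)) has_real_derivative bump 1 0 ((t - c) / r) * (1 / r)) (at t)" for c
    using assms by (intro DERIV_chain2[OF bump_step_has_derivative]) (auto intro!: derivative_eq_intros)
  from DERIV_diff[OF this[of a] this[of b]] show ?thesis
    by (simp add: plateau_def[abs_def])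
qed

lemma plateau_smooth:
  assumes "r > 0"
  shows "(deriv ^^ k) (plateau a b r) differentiable (at t)"
proof -
  \<comment> \<open>The plateau is not itself a combination of scaled bumps, so it is added by hand;
    differentiating either kind of member yields such a combination, hence P is closed under
    \<open>deriv\<close>.\<close>
  define P where "P = insert (plateau a b r)
    (range (\<lambda>(p, k, p', k', c, c'). \<lambda>t. c * bump p k ((t - a) / r) + c' * bump p' k' ((t - b) / r)))"
  have D: "f differentiable at x \<and> deriv f \<in> P" if "f \<in> P" for f x
    using that unfolding P_def
  proof (elim insertE)
    assume f: "f = plateau a b r"
    note D = plateau_has_derivative[OF assms, of a b]
    have "deriv f = (\<lambda>t. (1/r) * bump 1 0 ((t - a) / r) + (-1/r) * bump 1 0 ((t - b) / r))"
      using DERIV_imp_deriv[OF D] by (simp add: fun_eq_iff f)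
    then have "deriv f \<in> range (\<lambda>(p, k, p', k', c, c'). \<lambda>t. c * bump p k ((t - a) / r) + c' * bump p' k' ((t - b) / r))"
      by (intro range_eqI[where x="(1, 0, 1, 0, 1/r, -1/r)"]) simp
    then show "f differentiable at x \<and> deriv f \<in> insert (plateau a b r)
       (range (\<lambda>(p, k, p', k', c, c'). \<lambda>t. c * bump p k ((t - a) / r) + c' * bump p' k' ((t - b) / r)))"
      using D f unfolding real_differentiable_def by blast
  next
    assume "f \<in> range (\<lambda>(p, k, p', k', c, c'). \<lambda>t. c * bump p k ((t - a) / r) + c' * bump p' k' ((t - b) / r))"
    then obtain p k p' k' c c' where
      f: "f = (\<lambda>t. c * bump p k ((t - a) / r) + c' * bump p' k' ((t - b) / r))"
      by (auto split: prod.splits)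
    obtain p1 where p1: "\<And>x. (bump p k has_real_derivative bump p1 (k + 2) x) (at x)"
      using bump_has_derivative by blast
    obtain p2 where p2: "\<And>x. (bump p' k' has_real_derivative bump p2 (k' + 2) x) (at x)"
      using bump_has_derivative by blast
    have "((\<lambda>t. bump p k ((t - a) / r)) has_real_derivative bump p1 (k+2) ((t - a) / r) * (1 / r)) (at t)" for t
      using assms by (intro DERIV_chain2[OF p1]) (auto intro!: derivative_eq_intros)
    moreover have "((\<lambda>t. bump p' k' ((t - b) / r)) has_real_derivative bump p2 (k'+2) ((t - b) / r) * (1 / r)) (at t)" for t
      using assms by (intro DERIV_chain2[OF p2]) (auto intro!: derivative_eq_intros)
    ultimately have D: "(f has_real_derivative (c / r) * bump p1 (k+2) ((t - a) / r) + (c' / r) * bump p2 (k'+2) ((t - b) / r)) (at t)" for t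
      unfolding f by (auto intro!: derivative_eq_intros simp: mult.commute)
    then have "deriv f = (\<lambda>t. (c / r) * bump p1 (k+2) ((t - a) / r) + (c' / r) * bump p2 (k'+2) ((t - b) / r))"
      by (auto simp: fun_eq_iff dest!: DERIV_imp_deriv)
    then have "deriv f \<in> range (\<lambda>(p, k, p', k', c, c'). \<lambda>t. c * bump p k ((t - a) / r) + c' * bump p' k' ((t - b) / r))"
      by (intro range_eqI[where x="(p1, k+2, p2, k'+2, c/r, c'/r)"]) simp
    then show "f differentiable at x \<and> deriv f \<in> insert (plateau a b r)
       (range (\<lambda>(p, k, p', k', c, c'). \<lambda>t. c * bump p k ((t - a) / r) + c' * bump p' k' ((t - b) / r)))"
      using D by (auto simp: real_differentiable_def)
  qed
  show ?thesis
    by (rule iterated_deriv_differentiable[where P=P]) (use D in \<open>auto simp: P_def\<close>)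
qed


section \<open>From the distributional identity to an integral identity\<close>

lemma set_lebesgue_integral_supported:
  fixes k :: "real \<Rightarrow> real"
  assumes "continuous_on {a..c} k" "\<And>t. t \<notin> {a..c} \<Longrightarrow> k t = 0" "{a..c} \<subseteq> S"
  shows "(LINT t:S|lborel. k t) = integral {a..c} k"
proof -
  have "(LINT t:S|lborel. k t) = (LINT t:{a..c}|lborel. k t)"
    unfolding set_lebesgue_integral_def
    by (intro Bochner_Integration.integral_cong) (use assms in \<open>auto simp: indicator_def\<close>)
  also have "\<dots> = integral {a..c} k"
    by (intro set_borel_integral_eq_integral borel_integrable_atLeastAtMost' assms)
  finally show ?thesis .
qed

lemma continuous_bump_scaled [continuous_intros]:
  "continuous_on A (\<lambda>t. bump p k ((t - x) / r))"
  by (intro continuous_on_compose2[OF continuous_bump[of UNIV]])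
    (auto simp: divide_inverse intro!: continuous_intros)

text \<open>Scaled bumps form an approximate identity: the kernel is nonnegative, lives on
  \<open>{x..x + r}\<close> and has mass \<open>bump_step 1\<close>, so integrating against it reads
  off \<open>w x\<close> up to the oscillation of w there.\<close>

lemma integral_bump_approx:
  fixes w :: "real \<Rightarrow> real"
  assumes r: "r > 0" and x: "a \<le> x" "x + r \<le> c" and w: "continuous_on {a..c} w"
    and close: "\<And>t. t \<in> {x..x + r} \<Longrightarrow> \<bar>w t - w x\<bar> \<le> \<eta>"
  shows "\<bar>integral {a..c} (\<lambda>t. w t * (bump 1 0 ((t - x) / r) / r)) - w x * bump_step 1\<bar> \<le> \<eta> * bump_step 1"
proof -
  let ?\<beta> = "\<lambda>t. bump 1 0 ((t - x) / r) / r"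
  have "((\<lambda>t. bump_step ((t - x) / r)) has_real_derivative bump 1 0 ((t - x) / r) * (1 / r)) (at t)" for t
    using r by (intro DERIV_chain2[OF bump_step_has_derivative]) (auto intro!: derivative_eq_intros)
  then have "(?\<beta> has_integral (bump_step ((c - x) / r) - bump_step ((a - x) / r))) {a..c}"
    using x r by (intro fundamental_theorem_of_calculus)
      (auto simp: has_real_derivative_iff_has_vector_derivative[symmetric] intro: has_field_derivative_at_within)
  moreover have "bump_step ((c - x) / r) = bump_step 1" "bump_step ((a - x) / r) = 0"
    using x r by (auto intro!: bump_step_ge_1 bump_step_eq_0 simp: field_simps)
  ultimately have I: "(?\<beta> has_integral bump_step 1) {a..c}"
    by simp
  have J: "((\<lambda>t. w t * ?\<beta> t) has_integral integral {a..c} (\<lambda>t. w t * ?\<beta> t)) {a..c}"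
    by (intro integrable_integral integrable_continuous_interval continuous_intros w) (use r in auto)
  have D: "((\<lambda>t. (w t - w x) * ?\<beta> t) has_integral
      (integral {a..c} (\<lambda>t. w t * ?\<beta> t) - w x * bump_step 1)) {a..c}"
    using has_integral_diff[OF J has_integral_mult_right[OF I, of "w x"]] by (simp only: left_diff_distrib)
  have E: "((\<lambda>t. \<eta> * ?\<beta> t) has_integral \<eta> * bump_step 1) {a..c}"
    by (rule has_integral_mult_right[OF I])
  have "norm ((w t - w x) * ?\<beta> t) \<le> \<eta> * ?\<beta> t" for t
  proof (cases "t \<in> {x..x + r}")
    case True
    then show ?thesis
      using close[OF True] bump_1_nonneg[of "(t - x) / r"] r
      by (auto simp: abs_mult intro!: mult_right_mono divide_right_mono)
  next
    case False
    then have "bump 1 0 ((t - x) / r) = 0"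
      using r by (intro bump_eq_0) (auto simp: field_simps)
    then show ?thesis by simp
  qed
  then have "norm (integral {a..c} (\<lambda>t. (w t - w x) * ?\<beta> t)) \<le> integral {a..c} (\<lambda>t. \<eta> * ?\<beta> t)"
    using D E by (intro integral_norm_bound_integral) (auto simp: has_integral_iff)
  then show ?thesis
    by (simp only: integral_unique[OF D] integral_unique[OF E] real_norm_def)
qed

text \<open>The difference of g and a primitive of h has vanishing distributional derivative.
  Plateau test functions show that it is constant on positive times, and continuity extends this to
  time 0.\<close>

lemma distributional_deriv_has_integral:
  fixes g h :: "real \<Rightarrow> real"
  assumes deriv: "has_distributional_deriv_on g h {0<..}"
    and g: "continuous_on {0..} g" and h: "continuous_on {0..} h" and T: "0 \<le> T"
  shows "(h has_integral (g T - g 0)) {0..T}"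
proof -
  define H where "H t = integral {0..t} h" for t
  define w where "w t = g t - H t" for t
  have h_Icc: "continuous_on {a..c} h" if "0 \<le> a" for a c
    using h by (rule continuous_on_subset) (use that in auto)
  have g_Icc: "continuous_on {a..c} g" if "0 \<le> a" for a c
    using g by (rule continuous_on_subset) (use that in auto)
  have H_Icc: "continuous_on {0..c} H" for c
    unfolding H_def by (intro indefinite_integral_continuous_1 integrable_continuous_interval h_Icc) auto
  have w_Icc: "continuous_on {a..c} w" if "0 \<le> a" for a c
    unfolding w_def using that
    by (intro continuous_intros g_Icc continuous_on_subset[OF H_Icc[of c]]) auto
  have H_deriv: "(H has_real_derivative h t) (at t)" if "t > 0" for t
  proof -
    have "(H has_real_derivative h t) (at t within {0..t+1})"
      unfolding H_def[abs_def] using that by (intro integral_has_real_derivative h_Icc) auto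
    then show ?thesis using that by (subst (asm) at_within_Icc_at) auto
  qed
  have const: "w a = w b" if ab: "0 < a" "a < b" for a b
  proof (rule ccontr)
    assume "w a \<noteq> w b"
    \<comment> \<open>A third of the gap suffices: the approximations at a and b lose at most
      \<open>\<eta>\<close> each, in units of \<open>bump_step 1\<close>.\<close>
    define \<eta> where "\<eta> = \<bar>w a - w b\<bar> / 3"
    have \<eta>: "\<eta> > 0" using \<open>w a \<noteq> w b\<close> by (simp add: \<eta>_def)
    \<comment> \<open>One-sided neighbourhoods are enough because each bump sits to the right of its
      base point.\<close>
    have w_at: "\<exists>r>0. \<forall>t\<in>{x..x + r}. \<bar>w t - w x\<bar> \<le> \<eta>" if "x > 0" for x
    proof -
      have "continuous_on {x..x+1} w" using that by (intro w_Icc) auto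
      then obtain r where r: "r > 0" "\<And>t. t \<in> {x..x+1} \<Longrightarrow> dist t x < r \<Longrightarrow> dist (w t) (w x) < \<eta>"
        using \<eta> by (force simp: continuous_on_iff)
      show ?thesis
        by (rule exI[of _ "min 1 (r / 2)"])
          (use r in \<open>auto simp: dist_real_def intro!: less_imp_le\<close>)
    qed
    obtain r1 where r1: "r1 > 0" "\<And>t. t \<in> {a..a + r1} \<Longrightarrow> \<bar>w t - w a\<bar> \<le> \<eta>"
      using w_at[of a] ab by auto
    obtain r2 where r2: "r2 > 0" "\<And>t. t \<in> {b..b + r2} \<Longrightarrow> \<bar>w t - w b\<bar> \<le> \<eta>"
      using w_at[of b] ab by auto
    define r where "r = min r1 r2"
    have r: "r > 0" using r1 r2 by (simp add: r_def)
    \<comment> \<open>From c on both steps have levelled off, so the plateau and its derivative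
      vanish outside \<open>{a..c}\<close>.\<close>
    define c where "c = b + r"
    define \<psi> where "\<psi> = plateau a b r"
    define \<psi>' where "\<psi>' t = bump 1 0 ((t - a) / r) / r - bump 1 0 ((t - b) / r) / r" for t
    have \<psi>_deriv: "(\<psi> has_real_derivative \<psi>' t) (at t)" for t
      unfolding \<psi>_def \<psi>'_def by (rule plateau_has_derivative[OF r])
    have \<psi>_cont: "continuous_on A \<psi>" for A
      using \<psi>_deriv by (meson DERIV_isCont continuous_at_imp_continuous_on)
    have \<psi>'_cont: "continuous_on A \<psi>'" for A
      unfolding \<psi>'_def using r by (intro continuous_intros) auto
    have deriv_\<psi>: "deriv \<psi> = \<psi>'"
      by (intro ext DERIV_imp_deriv \<psi>_deriv)
    have supp: "\<psi> t = 0" if "t \<le> a \<or> c \<le> t" for t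
      using that
    proof
      assume "t \<le> a"
      then show ?thesis using r ab
        by (simp add: \<psi>_def plateau_def bump_step_eq_0 divide_nonpos_pos)
    next
      assume "c \<le> t"
      then have "1 \<le> (t - a) / r" "1 \<le> (t - b) / r" using r ab by (auto simp: c_def field_simps)
      then show ?thesis
        by (simp add: \<psi>_def plateau_def bump_step_ge_1[of "(t - a) / r"] bump_step_ge_1[of "(t - b) / r"])
    qed
    have supp': "\<psi>' t = 0" if "t \<notin> {a..c}" for t
      using that r ab bump_eq_0[of "(t - a) / r"] bump_eq_0[of "(t - b) / r"]
      by (auto simp: \<psi>'_def c_def field_simps)
    have "test_function_on {0<..} \<psi>"
      unfolding test_function_on_def
    proof (intro conjI allI)
      show "(deriv ^^ k) \<psi> differentiable (at t)" for k t
        unfolding \<psi>_def by (rule plateau_smooth[OF r])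
      show "\<exists>K. compact K \<and> K \<subseteq> {0<..} \<and> (\<forall>t. t \<notin> K \<longrightarrow> \<psi> t = 0)"
        using ab supp by (intro exI[of _ "{a..c}"]) auto
    qed
    then have "(LINT t:{0<..}|lborel. h t * \<psi> t) = - (LINT t:{0<..}|lborel. g t * \<psi>' t)"
      using deriv deriv_\<psi> by (simp add: has_distributional_deriv_on_def)
    moreover have "(LINT t:{0<..}|lborel. h t * \<psi> t) = integral {a..c} (\<lambda>t. h t * \<psi> t)"
      using ab supp by (intro set_lebesgue_integral_supported continuous_intros h_Icc \<psi>_cont) auto
    moreover have "(LINT t:{0<..}|lborel. g t * \<psi>' t) = integral {a..c} (\<lambda>t. g t * \<psi>' t)"
      using ab supp' by (intro set_lebesgue_integral_supported continuous_intros g_Icc \<psi>'_cont) auto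
    ultimately have eq: "integral {a..c} (\<lambda>t. h t * \<psi> t) = - integral {a..c} (\<lambda>t. g t * \<psi>' t)"
      by simp
    have H_ac: "continuous_on {a..c} H"
      using ab by (intro continuous_on_subset[OF H_Icc[of c]]) auto
    \<comment> \<open>Integration by parts: the boundary terms vanish, so h against
      \<open>\<psi>\<close> becomes minus H against \<open>\<psi>'\<close>, and the distributional
      identity reduces to w against \<open>\<psi>'\<close> being 0.\<close>
    have "((\<lambda>t. h t * \<psi> t + H t * \<psi>' t) has_integral (H c * \<psi> c - H a * \<psi> a)) {a..c}"
    proof (rule fundamental_theorem_of_calculus)
      show "a \<le> c" using ab r by (simp add: c_def)
      fix t assume "t \<in> {a..c}"
      then have "((\<lambda>t. H t * \<psi> t) has_real_derivative h t * \<psi> t + H t * \<psi>' t) (at t)"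
        using ab by (auto intro!: derivative_eq_intros H_deriv \<psi>_deriv)
      then show "((\<lambda>t. H t * \<psi> t) has_vector_derivative h t * \<psi> t + H t * \<psi>' t) (at t within {a..c})"
        by (simp add: has_real_derivative_iff_has_vector_derivative has_vector_derivative_at_within)
    qed
    then have "integral {a..c} (\<lambda>t. h t * \<psi> t + H t * \<psi>' t) = 0"
      using supp by (simp add: has_integral_iff)
    also have "integral {a..c} (\<lambda>t. h t * \<psi> t + H t * \<psi>' t) =
        integral {a..c} (\<lambda>t. h t * \<psi> t) + integral {a..c} (\<lambda>t. H t * \<psi>' t)"
      using ab by (intro Henstock_Kurzweil_Integration.integral_add integrable_continuous_interval
          continuous_intros h_Icc \<psi>_cont \<psi>'_cont H_ac) auto
    finally have "integral {a..c} (\<lambda>t. g t * \<psi>' t) - integral {a..c} (\<lambda>t. H t * \<psi>' t) = 0"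
      using eq by simp
    also have "integral {a..c} (\<lambda>t. g t * \<psi>' t) - integral {a..c} (\<lambda>t. H t * \<psi>' t) =
        integral {a..c} (\<lambda>t. w t * \<psi>' t)"
      unfolding w_def left_diff_distrib using ab
      by (intro Henstock_Kurzweil_Integration.integral_diff[symmetric] integrable_continuous_interval
          continuous_intros g_Icc \<psi>'_cont H_ac) auto
    also have "\<dots> = integral {a..c} (\<lambda>t. w t * (bump 1 0 ((t - a) / r) / r)) -
        integral {a..c} (\<lambda>t. w t * (bump 1 0 ((t - b) / r) / r))"
      unfolding \<psi>'_def right_diff_distrib using ab r
      by (intro Henstock_Kurzweil_Integration.integral_diff integrable_continuous_interval
          continuous_intros w_Icc) auto
    finally have swap: "integral {a..c} (\<lambda>t. w t * (bump 1 0 ((t - a) / r) / r)) =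
        integral {a..c} (\<lambda>t. w t * (bump 1 0 ((t - b) / r) / r))"
      by simp
    have approx: "\<bar>integral {a..c} (\<lambda>t. w t * (bump 1 0 ((t - x) / r) / r)) - w x * bump_step 1\<bar>
        \<le> \<eta> * bump_step 1" if "x = a \<or> x = b" for x
      using that ab r r1 r2 by (intro integral_bump_approx w_Icc) (auto simp: c_def r_def)
    have "\<bar>w a * bump_step 1 - w b * bump_step 1\<bar> \<le> 2 * (\<eta> * bump_step 1)"
      using approx[of a] approx[of b] unfolding swap by linarith
    then have "\<bar>w a - w b\<bar> * bump_step 1 \<le> 2 * \<eta> * bump_step 1"
      using bump_step_1_pos by (simp add: abs_mult flip: left_diff_distrib)
    then have "\<bar>w a - w b\<bar> \<le> 2 * \<eta>"
      using bump_step_1_pos by simp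
    then show False using \<eta> by (simp add: \<eta>_def)
  qed
  have "w T = w 0"
  proof (cases "T = 0")
    case False
    then have T: "T > 0" using T by simp
    \<comment> \<open>Constancy is known only for positive times; the value at 0 is recovered as a
      one-sided limit.\<close>
    have "continuous_on {0..T} w" by (intro w_Icc) auto
    then have "(w \<longlongrightarrow> w 0) (at 0 within {0..T})"
      using T by (simp add: continuous_on)
    moreover have "\<forall>\<^sub>F t in at 0 within {0..T}. w t = w T"
      unfolding eventually_at_filter
      using const[of _ T] by (intro always_eventually) (auto simp: less_le)
    ultimately have "((\<lambda>_. w T) \<longlongrightarrow> w 0) (at 0 within {0..T})"
      by (rule Lim_transform_eventually)
    moreover have "at 0 within {0..T} \<noteq> bot"
      using T by (simp add: trivial_limit_within islimpt_Icc)
    ultimately show ?thesis by (simp add: tendsto_const_iff)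
  qed simp
  then have "integral {0..T} h = g T - g 0"
    by (simp add: w_def H_def)
  moreover have "h integrable_on {0..T}"
    by (intro integrable_continuous_interval h_Icc) auto
  ultimately show ?thesis by (simp add: has_integral_iff)
qed

section \<open>Growth of sequences\<close>

text \<open>
  The constant of the quadratic bound \<open>qual\<close> does not occur in the conclusion: finiteness of the
  supremum of \<open>S n / (n (1 + \<epsilon> n))\<close> is all that is used. With \<open>\<delta> = 0\<close> and \<open>\<epsilon> \<rightarrow> 0\<close> the growth becomes
  linear.
\<close>
lemma growth_bound:
  fixes S :: "nat \<Rightarrow> real"
  assumes K: "K \<ge> 0" and \<delta>: "\<delta> \<ge> 0" and \<epsilon>: "\<epsilon> > 0"
    and nonneg: "\<And>n. S n \<ge> 0"
    and step: "\<And>n. S (Suc n) \<le> K * sqrt (real (Suc n) * S (n + 2)) + \<delta> * (real (Suc n))\<^sup>2"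
    and qual: "\<And>n. S (Suc n) \<le> C * (real (Suc n))\<^sup>2"
  shows "S (Suc n) \<le> (9 * K\<^sup>2 + 2 * \<delta> / \<epsilon>) * (real (Suc n) * (1 + \<epsilon> * real (Suc n)))"
proof -
  \<comment> \<open>At index n the weight dominates both n + 1 and \<open>\<epsilon>\<close> (n +
    1)^2, and it grows at most ninefold from one index to the next.\<close>
  define w where "w n = real (Suc n) * (1 + \<epsilon> * real (Suc n))" for n
  have w1: "w n \<ge> real (Suc n)" for n
    using \<epsilon> by (simp add: w_def algebra_simps)
  have w_pos: "w n > 0" for n using w1[of n] by simp
  have w2: "\<epsilon> * (real (Suc n))\<^sup>2 \<le> w n" for n
    by (simp add: w_def power2_eq_square algebra_simps)
  have w3: "w (Suc n) \<le> 9 * w n" for n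
  proof -
    have "real (Suc (Suc n)) * (1 + \<epsilon> * real (Suc (Suc n))) \<le> (3 * real (Suc n)) * (3 * (1 + \<epsilon> * real (Suc n)))"
    proof (rule mult_mono)
      have "\<epsilon> * real (Suc (Suc n)) \<le> \<epsilon> * (3 * real (Suc n))"
        using \<epsilon> by (intro mult_left_mono) auto
      then show "1 + \<epsilon> * real (Suc (Suc n)) \<le> 3 * (1 + \<epsilon> * real (Suc n))" by (simp add: algebra_simps)
    qed (use \<epsilon> in auto)
    then show ?thesis by (simp add: w_def algebra_simps)
  qed
  \<comment> \<open>The quadratic bound makes this supremum finite; the recursion then bounds it in
    terms of its own square root.\<close>
  define A where "A = (SUP n. S (Suc n) / w n)"
  have "C \<ge> 0" using qual[of 0] nonneg[of 1] by simp
  have bdd: "bdd_above (range (\<lambda>n. S (Suc n) / w n))"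
  proof (rule bdd_aboveI2)
    fix n
    have "S (Suc n) \<le> C / \<epsilon> * (\<epsilon> * (real (Suc n))\<^sup>2)" using qual[of n] \<epsilon> by simp
    also have "\<dots> \<le> C / \<epsilon> * w n" using \<open>C \<ge> 0\<close> \<epsilon> w2 by (intro mult_left_mono) auto
    finally show "S (Suc n) / w n \<le> C / \<epsilon>" using w_pos[of n] by (simp add: field_simps)
  qed
  have SA: "S (Suc n) \<le> A * w n" for n
    using cSUP_upper[OF _ bdd, of n] w_pos[of n] by (simp add: A_def field_simps)
  have A0: "A \<ge> 0"
    using order_trans[OF nonneg SA[of 0]] w_pos[of 0] by (simp add: zero_le_mult_iff)
  have "A \<le> 3 * K * sqrt A + \<delta> / \<epsilon>"
    unfolding A_def
  proof (rule cSUP_least)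
    fix n
    have "real (Suc n) * S (n + 2) \<le> w n * (A * (9 * w n))"
      using SA[of "Suc n"] w3[of n] w1[of n] A0 nonneg w_pos[of n]
      by (intro mult_mono) (auto intro: order_trans[OF _ mult_left_mono])
    also have "\<dots> = A * (3 * w n)\<^sup>2" by (simp add: power2_eq_square)
    finally have "sqrt (real (Suc n) * S (n + 2)) \<le> sqrt (A * (3 * w n)\<^sup>2)"
      by (rule real_sqrt_le_mono)
    also have "\<dots> = sqrt A * (3 * w n)" using w_pos[of n] by (simp add: real_sqrt_mult)
    finally have "S (Suc n) \<le> K * (sqrt A * (3 * w n)) + \<delta> / \<epsilon> * (\<epsilon> * (real (Suc n))\<^sup>2)"
      using step[of n] K \<epsilon> by (smt (verit) mult_left_mono nonzero_eq_divide_eq times_divide_eq_left mult.assoc)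
    also have "\<dots> \<le> K * (sqrt A * (3 * w n)) + \<delta> / \<epsilon> * w n"
      using \<delta> \<epsilon> w2 by (intro add_left_mono mult_left_mono) auto
    finally show "S (Suc n) / w n \<le> 3 * K * sqrt (SUP n. S (Suc n) / w n) + \<delta> / \<epsilon>"
      using w_pos[of n] by (simp add: A_def[symmetric] pos_divide_le_eq algebra_simps)
  qed simp
  \<comment> \<open>Half of A is absorbed into the left side, which leaves a constant free of
    C.\<close>
  moreover have "3 * K * sqrt A \<le> A / 2 + 9 * K\<^sup>2 / 2"
  proof -
    have "0 \<le> (sqrt A - 3 * K)\<^sup>2" by simp
    also have "\<dots> = A - 2 * (3 * K * sqrt A) + 9 * K\<^sup>2"
      using A0 by (simp add: power2_eq_square algebra_simps)
    finally show ?thesis by simp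
  qed
  ultimately have "A \<le> 9 * K\<^sup>2 + 2 * \<delta> / \<epsilon>" by simp
  then have "A * w n \<le> (9 * K\<^sup>2 + 2 * \<delta> / \<epsilon>) * w n"
    using w_pos[of n] by (intro mult_right_mono) auto
  with SA[of n] have "S (Suc n) \<le> (9 * K\<^sup>2 + 2 * \<delta> / \<epsilon>) * w n" by (rule order_trans)
  then show ?thesis by (simp only: w_def)
qed

text \<open>
  A discrete form of \<open>S' \<ge> S\<^sup>2 / (c n)\<close>: the increments of \<open>1 / S\<close> are at least of order \<open>1 / n\<close>,
  which the divergence of the harmonic series forbids.
\<close>
lemma riccati_sequence_eq_0:
  fixes S :: "nat \<Rightarrow> real"
  assumes K: "K \<ge> 0"
    and nonneg: "\<And>n. S n \<ge> 0"
    and mono: "\<And>n. S n \<le> S (Suc n)"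
    and step: "\<And>n. S (Suc n) \<le> K * sqrt (real (Suc n) * (S (n + 2) - S n))"
    and linear: "\<And>n. S (Suc n) \<le> C * real (Suc n)"
  shows "S m = 0"
proof (rule ccontr)
  assume "S m \<noteq> 0"
  then have Sm: "S m > 0" using nonneg[of m] by simp
  have incr: "S i \<le> S j" if "i \<le> j" for i j
    using lift_Suc_mono_le[of S] mono that by blast
  \<comment> \<open>Chosen to bound both summands of \<open>a + L\<close> below: \<open>L\<close> is
    K^2 (n + 1), and \<open>a\<close> is at most |C| (n + 1) by the linear bound.\<close>
  define \<kappa> where "\<kappa> = K\<^sup>2 + \<bar>C\<bar>"
  have pos: "S n > 0" if "n \<ge> m" for n using Sm incr[OF that] by simp
  have \<kappa>: "\<kappa> > 0"
  proof -
    have "0 < C * real (Suc m)" using linear[of m] pos[of "Suc m"] by simp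
    then have "C > 0" by (simp add: zero_less_mult_iff)
    then show ?thesis by (simp add: \<kappa>_def add_nonneg_pos)
  qed
  have key: "1 / real (Suc n) \<le> \<kappa> * (1 / S n - 1 / S (n + 2))" if n: "n \<ge> m" for n
  proof -
    define a c L where "a = S n" and "c = S (n + 2)" and "L = K\<^sup>2 * real (Suc n)"
    have a: "a > 0" "a \<le> c" using pos[OF n] incr[of n "n+2"] by (auto simp: a_def c_def)
    have "a \<le> K * sqrt (real (Suc n) * (c - a))"
      using step[of n] mono[of n] by (simp add: a_def c_def)
    then have "a\<^sup>2 \<le> (K * sqrt (real (Suc n) * (c - a)))\<^sup>2"
      using a by (intro power_mono) auto
    also have "\<dots> = L * (c - a)"
      using a by (simp add: power_mult_distrib L_def)
    finally have 1: "a\<^sup>2 \<le> L * (c - a)" .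
    have aL: "a + L \<le> \<kappa> * real (Suc n)"
    proof -
      have "a \<le> \<bar>C\<bar> * real (Suc n)"
        using linear[of n] mono[of n] by (auto simp: a_def intro: order_trans mult_right_mono)
      then show ?thesis by (simp add: \<kappa>_def L_def algebra_simps)
    qed
    \<comment> \<open>Obtained by adding a (c - a) to both sides of the squared recursion; dividing
      by a c turns it into an increment of 1 / S.\<close>
    have "a * c \<le> (a + L) * (c - a)"
      using 1 by (simp add: power2_eq_square algebra_simps)
    also have "\<dots> \<le> \<kappa> * real (Suc n) * (c - a)"
      using aL a by (intro mult_right_mono) auto
    finally have "a * c \<le> \<kappa> * real (Suc n) * (c - a)" .
    then have "1 / real (Suc n) \<le> \<kappa> * ((c - a) / (a * c))"
      using a by (simp add: field_simps)
    also have "(c - a) / (a * c) = 1 / a - 1 / c" using a by (simp add: field_simps)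
    finally show ?thesis by (simp add: a_def c_def)
  qed
  \<comment> \<open>The increments skip one index, so telescoping leaves two terms at each
    end.\<close>
  have sum: "(\<Sum>n=m..<m+k. 1 / S n - 1 / S (n + 2)) =
      1 / S m + 1 / S (Suc m) - 1 / S (m + k) - 1 / S (Suc (m + k))" for k
    by (induction k) (auto simp: algebra_simps)
  have bound: "(\<Sum>n<k. 1 / real (Suc (n + m))) \<le> 2 * \<kappa> / S m" for k
  proof -
    have "(\<Sum>n<k. 1 / real (Suc (n + m))) = (\<Sum>n=m..<m+k. 1 / real (Suc n))"
      by (rule sum.reindex_bij_witness[of _ "\<lambda>n. n - m" "\<lambda>n. n + m"]) auto
    also have "\<dots> \<le> (\<Sum>n=m..<m+k. \<kappa> * (1 / S n - 1 / S (n + 2)))"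
      by (intro sum_mono key) auto
    also have "\<dots> = \<kappa> * (1 / S m + 1 / S (Suc m) - 1 / S (m + k) - 1 / S (Suc (m + k)))"
      by (simp only: sum sum_distrib_left[symmetric])
    also have "\<dots> \<le> \<kappa> * (1 / S m + 1 / S m)"
    proof (intro mult_left_mono)
      have "1 / S (Suc m) \<le> 1 / S m" using Sm mono[of m] by (intro divide_left_mono) auto
      then show "1 / S m + 1 / S (Suc m) - 1 / S (m + k) - 1 / S (Suc (m + k)) \<le> 1 / S m + 1 / S m"
        using pos[of "m+k"] pos[of "Suc (m+k)"] by (smt (verit) divide_nonneg_pos le_add1 le_SucI)
    qed (use \<kappa> in auto)
    finally show ?thesis by (simp add: mult.commute)
  qed
  have "summable (\<lambda>n. 1 / real (Suc (n + m)))"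
    by (rule summableI_nonneg_bounded[where x="2 * \<kappa> / S m"]) (use bound in auto)
  then have "summable (\<lambda>n. inverse (of_nat (Suc (n + m)) :: real))"
    by (simp add: divide_inverse)
  then have "summable (\<lambda>n. inverse (of_nat (Suc n) :: real))"
    using summable_iff_shift[of "\<lambda>n. inverse (of_nat (Suc n) :: real)" m] by simp
  then show False
    using summable_Suc_iff[of "\<lambda>n. inverse (of_nat n :: real)"] not_summable_harmonic by auto
qed

section \<open>Boxes in the lattice\<close>

definition lattice_box :: "nat \<Rightarrow> (int ^ 'n::finite) set" where
  "lattice_box n = {\<alpha>. \<forall>i. \<bar>\<alpha> $ i\<bar> \<le> int n}"

lemma lattice_box_eq_image:
  "(lattice_box n :: (int ^ 'n::finite) set) = vec_lambda ` (UNIV \<rightarrow>\<^sub>E {- int n..int n})"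
proof -
  have abs_le: "\<bar>x\<bar> \<le> int n \<longleftrightarrow> x \<in> {- int n..int n}" for x
    by auto
  have "(lattice_box n :: (int ^ 'n) set) = {\<alpha>. vec_nth \<alpha> \<in> UNIV \<rightarrow>\<^sub>E {- int n..int n}}"
    by (simp only: lattice_box_def abs_le PiE_iff) simp
  also have "\<dots> = vec_lambda ` (UNIV \<rightarrow>\<^sub>E {- int n..int n})"
  proof (intro equalityI subsetI)
    fix \<alpha> :: "int ^ 'n"
    assume "\<alpha> \<in> {\<alpha>. vec_nth \<alpha> \<in> UNIV \<rightarrow>\<^sub>E {- int n..int n}}"
    then show "\<alpha> \<in> vec_lambda ` (UNIV \<rightarrow>\<^sub>E {- int n..int n})"
      by (intro image_eqI[where x = "vec_nth \<alpha>"]) (simp_all only: vec_nth_inverse mem_Collect_eq)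
  next
    fix \<alpha> :: "int ^ 'n"
    assume "\<alpha> \<in> vec_lambda ` (UNIV \<rightarrow>\<^sub>E {- int n..int n})"
    then show "\<alpha> \<in> {\<alpha>. vec_nth \<alpha> \<in> UNIV \<rightarrow>\<^sub>E {- int n..int n}}"
      by (elim imageE) (simp only: vec_lambda_inverse UNIV_I mem_Collect_eq)
  qed
  finally show ?thesis .
qed

lemma finite_lattice_box [simp]: "finite (lattice_box n :: (int ^ 'n::finite) set)"
  unfolding lattice_box_eq_image by (intro finite_imageI finite_PiE) auto

lemma card_lattice_box: "card (lattice_box n :: (int ^ 'n::finite) set) = (2 * n + 1) ^ CARD('n)"
proof -
  have "inj_on vec_lambda (UNIV \<rightarrow>\<^sub>E {- int n..int n} :: ('n \<Rightarrow> int) set)"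
    by (rule inj_onI) (metis vec_lambda_inverse UNIV_I)
  then show ?thesis
    unfolding lattice_box_eq_image by (simp add: card_image card_PiE nat_add_distrib nat_mult_distrib)
qed

lemma lattice_box_mono: "m \<le> n \<Longrightarrow> lattice_box m \<subseteq> lattice_box n"
  unfolding lattice_box_def
  by (intro subsetI CollectI allI) (simp only: mem_Collect_eq, meson of_nat_mono order_trans)

lemma mem_lattice_box: "\<exists>n. \<alpha> \<in> lattice_box n"
proof
  have "\<bar>\<alpha> $ i\<bar> \<le> (\<Sum>j\<in>UNIV. \<bar>\<alpha> $ j\<bar>)" for i
    by (rule member_le_sum) auto
  then show "\<alpha> \<in> lattice_box (nat (\<Sum>j\<in>UNIV. \<bar>\<alpha> $ j\<bar>))"
    by (simp add: lattice_box_def sum_nonneg)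
qed

section \<open>Discrete divergence theorem and shell estimates\<close>

lemma sum_diff_le_sum_abs:
  fixes g :: "'b \<Rightarrow> real"
  assumes "finite D" "A \<subseteq> D" "B \<subseteq> D" "C \<subseteq> A" "C \<subseteq> B"
  shows "\<bar>sum g A - sum g B\<bar> \<le> (\<Sum>x\<in>D - C. \<bar>g x\<bar>)"
proof -
  have fin: "finite A" "finite B" using assms by (auto intro: finite_subset)
  \<comment> \<open>Common points cancel and leave the symmetric difference, which lies in
    \<open>D - C\<close>.\<close>
  have "sum g A - sum g B = sum g (A - B) - sum g (B - A)"
    using fin by (simp add: sum_diff sum.Int_Diff[of A g B] sum.Int_Diff[of B g A] Int_commute)
  also have "\<bar>\<dots>\<bar> \<le> (\<Sum>x\<in>A - B. \<bar>g x\<bar>) + (\<Sum>x\<in>B - A. \<bar>g x\<bar>)"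
    by (rule order_trans[OF abs_triangle_ineq4 add_mono]) (rule sum_abs)+
  also have "\<dots> = (\<Sum>x\<in>(A - B) \<union> (B - A). \<bar>g x\<bar>)"
    using fin by (intro sum.union_disjoint[symmetric]) auto
  also have "\<dots> \<le> (\<Sum>x\<in>D - C. \<bar>g x\<bar>)"
    using assms by (intro sum_mono2) auto
  finally show ?thesis .
qed

text \<open>Discrete divergence theorem: in direction j the sum is the difference between the sums
  of the j-th flux component over the box and over its translate by one step. Both sets lie between
  the boxes of radius n and n + 2, so all cancels except in the shell between these.\<close>

lemma abs_sum_lattice_div_le:
  fixes F :: "int ^ 'n::finite \<Rightarrow> real ^ 'n"
  shows "\<bar>\<Sum>\<alpha>\<in>lattice_box (Suc n). lattice_div F \<alpha>\<bar>
    \<le> (\<Sum>j\<in>UNIV. \<Sum>\<alpha>\<in>lattice_box (n + 2) - lattice_box n. \<bar>F \<alpha> $ j\<bar>)"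
proof -
  have "(\<Sum>\<alpha>\<in>lattice_box (Suc n). lattice_div F \<alpha>) =
      (\<Sum>j\<in>UNIV. (\<Sum>\<alpha>\<in>lattice_box (Suc n). F \<alpha> $ j) - (\<Sum>\<alpha>\<in>lattice_box (Suc n). F (\<alpha> - axis j 1) $ j))"
    unfolding lattice_div_def by (subst sum.swap) (simp add: sum_subtractf)
  also have "\<bar>\<dots>\<bar> \<le> (\<Sum>j\<in>UNIV. \<bar>(\<Sum>\<alpha>\<in>lattice_box (Suc n). F \<alpha> $ j) -
      (\<Sum>\<alpha>\<in>lattice_box (Suc n). F (\<alpha> - axis j 1) $ j)\<bar>)"
    by (rule sum_abs)
  also have "\<dots> \<le> (\<Sum>j\<in>UNIV. \<Sum>\<alpha>\<in>lattice_box (n + 2) - lattice_box n. \<bar>F \<alpha> $ j\<bar>)"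
  proof (rule sum_mono)
    fix j :: 'n
    define shift where "shift = (\<lambda>\<alpha> :: int ^ 'n. \<alpha> - axis j 1) ` lattice_box (Suc n)"
    have mem: "\<alpha> \<in> shift \<longleftrightarrow> \<alpha> + axis j 1 \<in> lattice_box (Suc n)" for \<alpha>
      by (force simp: shift_def image_iff algebra_simps)
    have ax: "\<bar>(axis j 1 :: int ^ 'n) $ i\<bar> \<le> 1" for i
      by (simp add: axis_def)
    have "(\<Sum>\<alpha>\<in>lattice_box (Suc n). F (\<alpha> - axis j 1) $ j) = (\<Sum>\<alpha>\<in>shift. F \<alpha> $ j)"
      unfolding shift_def by (subst sum.reindex) (auto simp: inj_on_def)
    moreover have "\<bar>(\<Sum>\<alpha>\<in>lattice_box (Suc n). F \<alpha> $ j) - (\<Sum>\<alpha>\<in>shift. F \<alpha> $ j)\<bar>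
        \<le> (\<Sum>\<alpha>\<in>lattice_box (n + 2) - lattice_box n. \<bar>F \<alpha> $ j\<bar>)"
    proof (rule sum_diff_le_sum_abs)
      show "shift \<subseteq> lattice_box (n + 2)"
      proof
        fix \<alpha> assume "\<alpha> \<in> shift"
        then have *: "\<bar>\<alpha> $ i + (axis j 1 :: int ^ 'n) $ i\<bar> \<le> int (Suc n)" for i
          unfolding mem lattice_box_def by simp
        have "\<bar>\<alpha> $ i\<bar> \<le> int (n + 2)" for i
          using *[of i] ax[of i] by simp
        then show "\<alpha> \<in> lattice_box (n + 2)" by (simp add: lattice_box_def)
      qed
      show "lattice_box n \<subseteq> shift"
      proof
        fix \<alpha> :: "int ^ 'n" assume "\<alpha> \<in> lattice_box n"
        then have *: "\<bar>\<alpha> $ i\<bar> \<le> int n" for i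
          by (simp add: lattice_box_def)
        have "\<bar>\<alpha> $ i + (axis j 1 :: int ^ 'n) $ i\<bar> \<le> int (Suc n)" for i
          using *[of i] ax[of i] by simp
        then show "\<alpha> \<in> shift" by (simp add: mem lattice_box_def)
      qed
    qed (auto intro!: lattice_box_mono)
    ultimately show "\<bar>(\<Sum>\<alpha>\<in>lattice_box (Suc n). F \<alpha> $ j) - (\<Sum>\<alpha>\<in>lattice_box (Suc n). F (\<alpha> - axis j 1) $ j)\<bar>
        \<le> (\<Sum>\<alpha>\<in>lattice_box (n + 2) - lattice_box n. \<bar>F \<alpha> $ j\<bar>)"
      by simp
  qed
  finally show ?thesis .
qed

text \<open>The shell has 4 points for N = 1 and 16 n + 24 for N = 2. Linear growth is what later
  produces the divergent harmonic series.\<close>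

lemma card_lattice_shell_le:
  assumes "CARD('n::finite) = 1 \<or> CARD('n) = 2"
  shows "real (card (lattice_box (n + 2) - lattice_box n :: (int ^ 'n) set)) \<le> 24 * real (Suc n)"
proof -
  have "card (lattice_box (n + 2) - lattice_box n :: (int ^ 'n) set) =
      (2 * (n + 2) + 1) ^ CARD('n) - (2 * n + 1) ^ CARD('n)"
    by (subst card_Diff_subset) (auto simp: card_lattice_box intro!: lattice_box_mono)
  also have "\<dots> \<le> 24 * Suc n"
    using assms by (auto simp: power2_eq_square algebra_simps)
  finally have "real (card (lattice_box (n + 2) - lattice_box n :: (int ^ 'n) set)) \<le> real (24 * Suc n)"
    by (simp only: of_nat_le_iff)
  then show ?thesis by simp
qed

lemma card_lattice_box_le:
  assumes "CARD('n::finite) = 1 \<or> CARD('n) = 2"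
  shows "real (card (lattice_box (Suc n) :: (int ^ 'n) set)) \<le> 9 * (real (Suc n))\<^sup>2"
proof -
  have "card (lattice_box (Suc n) :: (int ^ 'n) set) \<le> 9 * (Suc n)\<^sup>2"
    unfolding card_lattice_box using assms by (auto simp: power2_eq_square algebra_simps)
  then have "real (card (lattice_box (Suc n) :: (int ^ 'n) set)) \<le> real (9 * (Suc n)\<^sup>2)"
    by (simp only: of_nat_le_iff)
  then show ?thesis by simp
qed

text \<open>Summing the balance leaves the flux through the shell, and Cauchy-Schwarz trades it for
  the dissipation there. The 24 comes from the shell size, the 2 from the number of flux components,
  the 9 from the box size.\<close>

lemma sum_lattice_box_step:
  fixes D :: "int ^ 'n::finite \<Rightarrow> real" and F :: "int ^ 'n \<Rightarrow> real ^ 'n"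
  assumes N: "CARD('n) = 1 \<or> CARD('n) = 2"
    and B: "B \<ge> 0" and D: "\<And>\<alpha>. D \<alpha> \<ge> 0" and \<delta>: "\<delta> \<ge> 0"
    and flux: "\<And>\<alpha> j. (F \<alpha> $ j)\<^sup>2 \<le> B * D \<alpha>"
    and balance: "\<And>\<alpha>. D \<alpha> \<le> lattice_div F \<alpha> + \<delta>"
  shows "sum D (lattice_box (Suc n)) \<le>
    2 * sqrt (24 * B) * sqrt (real (Suc n) * (sum D (lattice_box (n + 2)) - sum D (lattice_box n))) +
    9 * \<delta> * (real (Suc n))\<^sup>2"
proof -
  let ?R = "lattice_box (n + 2) - lattice_box n :: (int ^ 'n) set"
  have "sum D (lattice_box (Suc n)) \<le> (\<Sum>\<alpha>\<in>lattice_box (Suc n). lattice_div F \<alpha> + \<delta>)"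
    by (intro sum_mono balance)
  also have "\<dots> = (\<Sum>\<alpha>\<in>lattice_box (Suc n). lattice_div F \<alpha>) +
      real (card (lattice_box (Suc n) :: (int ^ 'n) set)) * \<delta>"
    by (simp add: sum.distrib)
  also have "\<dots> \<le> (\<Sum>j\<in>UNIV. \<Sum>\<alpha>\<in>?R. \<bar>F \<alpha> $ j\<bar>) + 9 * (real (Suc n))\<^sup>2 * \<delta>"
    using \<delta> abs_sum_lattice_div_le[of F n]
    by (intro add_mono mult_right_mono card_lattice_box_le N) auto
  also have "(\<Sum>j\<in>UNIV. \<Sum>\<alpha>\<in>?R. \<bar>F \<alpha> $ j\<bar>) \<le>
      (\<Sum>j\<in>(UNIV :: 'n set). sqrt (24 * B) * sqrt (real (Suc n) * sum D ?R))"
  proof (rule sum_mono)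
    fix j :: 'n
    \<comment> \<open>The explicit factor 1 makes Cauchy-Schwarz produce the cardinality of the
      shell.\<close>
    have "(\<Sum>\<alpha>\<in>?R. 1 * \<bar>F \<alpha> $ j\<bar>)\<^sup>2 \<le> (\<Sum>\<alpha>\<in>?R. 1\<^sup>2) * (\<Sum>\<alpha>\<in>?R. \<bar>F \<alpha> $ j\<bar>\<^sup>2)"
      by (rule Cauchy_Schwarz_ineq_sum)
    also have "\<dots> \<le> (24 * real (Suc n)) * (\<Sum>\<alpha>\<in>?R. B * D \<alpha>)"
      using card_lattice_shell_le[OF N, of n] flux
      by (intro mult_mono sum_mono) (auto intro: sum_nonneg)
    also have "\<dots> = (24 * B) * (real (Suc n) * sum D ?R)"
      by (simp add: sum_distrib_left[symmetric])
    finally have "(\<Sum>\<alpha>\<in>?R. \<bar>F \<alpha> $ j\<bar>) \<le> sqrt ((24 * B) * (real (Suc n) * sum D ?R))"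
      unfolding mult_1 by (rule real_le_rsqrt)
    then show "(\<Sum>\<alpha>\<in>?R. \<bar>F \<alpha> $ j\<bar>) \<le> sqrt (24 * B) * sqrt (real (Suc n) * sum D ?R)"
      by (simp only: real_sqrt_mult)
  qed
  also have "(\<Sum>j\<in>(UNIV :: 'n set). sqrt (24 * B) * sqrt (real (Suc n) * sum D ?R)) \<le>
      2 * (sqrt (24 * B) * sqrt (real (Suc n) * sum D ?R))"
  proof -
    have "0 \<le> sqrt (24 * B) * sqrt (real (Suc n) * sum D ?R)"
      using B D by (intro mult_nonneg_nonneg real_sqrt_ge_zero sum_nonneg) auto
    then have "real CARD('n) * (sqrt (24 * B) * sqrt (real (Suc n) * sum D ?R)) \<le>
        2 * (sqrt (24 * B) * sqrt (real (Suc n) * sum D ?R))"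
      using N by (intro mult_right_mono) auto
    then show ?thesis by simp
  qed
  also have "sum D ?R = sum D (lattice_box (n + 2)) - sum D (lattice_box n)"
    by (intro sum_diff lattice_box_mono) auto
  finally show ?thesis by (simp add: algebra_simps)
qed

text \<open>Jensen's inequality for the square, obtained by integrating the squared deviation of g
  from its mean \<open>m\<close>.\<close>

lemma integral_power2_le:
  fixes g :: "real \<Rightarrow> real"
  assumes "continuous_on {0..T} g" "T > 0"
  shows "(integral {0..T} g / T)\<^sup>2 \<le> integral {0..T} (\<lambda>t. (g t)\<^sup>2) / T"
proof -
  define m where "m = integral {0..T} g / T"
  have g: "(g has_integral m * T) {0..T}"
    using assms by (simp add: m_def has_integral_iff integrable_continuous_interval)
  have g2: "((\<lambda>t. (g t)\<^sup>2) has_integral integral {0..T} (\<lambda>t. (g t)\<^sup>2)) {0..T}"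
    using assms by (intro integrable_integral integrable_continuous_interval continuous_intros)
  have c: "((\<lambda>t. m\<^sup>2) has_integral m\<^sup>2 * T) {0..T}"
    using has_integral_const_real[of "m\<^sup>2" 0 T] assms by (simp add: mult.commute)
  have "((\<lambda>t. (g t)\<^sup>2 - 2 * m * g t + m\<^sup>2) has_integral
      integral {0..T} (\<lambda>t. (g t)\<^sup>2) - 2 * m * (m * T) + m\<^sup>2 * T) {0..T}"
    by (intro has_integral_add has_integral_diff has_integral_mult_right g g2 c)
  moreover have "(g t)\<^sup>2 - 2 * m * g t + m\<^sup>2 \<ge> 0" for t
    using zero_le_power2[of "g t - m"] by (simp add: power2_eq_square algebra_simps)
  ultimately have "0 \<le> integral {0..T} (\<lambda>t. (g t)\<^sup>2) - 2 * m * (m * T) + m\<^sup>2 * T"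
    by (rule has_integral_nonneg)
  then show ?thesis
    using assms unfolding m_def[symmetric] by (simp add: field_simps power2_eq_square)
qed

section \<open>Time averages along orbits\<close>

lemma linf_norm_nonneg:
  assumes "bounded (range g)"
  shows "0 \<le> linf_norm g"
  unfolding linf_norm_def
  using assms by (intro cSUP_upper2[OF _ UNIV_I]) (auto simp: bounded_iff intro: bdd_aboveI2)

lemma norm_le_linf_norm:
  assumes "bounded (range g)"
  shows "norm (g \<alpha>) \<le> linf_norm g"
  unfolding linf_norm_def
  using assms by (intro cSUP_upper) (auto simp: bounded_iff intro: bdd_aboveI2)

context semiflow
begin

lemma flow_in_topspace: "u \<in> topspace X \<Longrightarrow> t \<ge> 0 \<Longrightarrow> \<phi> u t \<in> topspace X"
  using continuous_map_image_subset_topspace[OF continuous_flow] by (force simp: image_subset_iff)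

lemma continuous_map_flow: "t \<ge> 0 \<Longrightarrow> continuous_map X X (\<lambda>u. \<phi> u t)"
  using continuous_map_compose[OF _ continuous_flow, of X "\<lambda>u. (u, t)"]
  by (simp add: o_def continuous_map_pairwise)

lemma continuous_map_orbit:
  assumes u: "u \<in> topspace X"
  shows "continuous_map (top_of_set {0..}) X (\<lambda>t. \<phi> u t)"
proof -
  have "continuous_map (top_of_set {0..}) (prod_topology X (top_of_set {0..})) (\<lambda>t. (u, t))"
    using u by (simp add: continuous_map_pairwise o_def)
  from continuous_map_compose[OF this continuous_flow] show ?thesis
    by (simp add: o_def)
qed

lemma continuous_on_orbit:
  assumes "u \<in> topspace X" "continuous_map X euclideanreal g"
  shows "continuous_on {0..} (\<lambda>t. g (\<phi> u t))"
  using continuous_map_compose[OF continuous_map_orbit[OF assms(1)] assms(2)] by (simp add: o_def)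

end

context lattice_EDS
begin

lemma energy_integral:
  assumes u: "u \<in> topspace X" and T: "0 \<le> T"
  shows "((\<lambda>t. - d (\<phi> u t) \<alpha> + lattice_div (f (\<phi> u t)) \<alpha>) has_integral
    (e (\<phi> u T) \<alpha> - e u \<alpha>)) {0..T}"
proof -
  have "((\<lambda>t. - d (\<phi> u t) \<alpha> + lattice_div (f (\<phi> u t)) \<alpha>) has_integral
      (e (\<phi> u T) \<alpha> - e (\<phi> u 0) \<alpha>)) {0..T}"
    unfolding lattice_div_def
    by (intro distributional_deriv_has_integral T energy_balance[OF u, unfolded lattice_div_def]
        continuous_intros continuous_on_orbit[OF u] continuous_energy continuous_dissipation continuous_flux)
  then show ?thesis using flow_zero[OF u] by simp
qed

definition avg :: "('a \<Rightarrow> real) \<Rightarrow> 'a \<Rightarrow> real \<Rightarrow> real" where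
  "avg g u T = integral {0..T} (\<lambda>t. g (\<phi> u t)) / T"

lemma continuous_on_orbit_Icc:
  assumes "u \<in> topspace X" "continuous_map X euclideanreal g"
  shows "continuous_on {0..T} (\<lambda>t. g (\<phi> u t))"
  using continuous_on_orbit[OF assms] by (rule continuous_on_subset) auto

lemma orbit_integrable:
  assumes "u \<in> topspace X" "continuous_map X euclideanreal g"
  shows "(\<lambda>t. g (\<phi> u t)) integrable_on {0..T}"
  by (intro integrable_continuous_interval continuous_on_orbit_Icc assms)

lemma avg_dissipation_nonneg:
  assumes "u \<in> topspace X" "T > 0"
  shows "avg (\<lambda>v. d v \<alpha>) u T \<ge> 0"
  using assms unfolding avg_def
  by (intro divide_nonneg_pos Henstock_Kurzweil_Integration.integral_nonneg orbit_integrable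
      continuous_dissipation) (auto intro: flow_in_topspace dissipation_nonneg)

text \<open>Averaging commutes with the finite sum in the divergence, and the energy change over
  \<open>[0, T]\<close> survives only as a remainder divided by T.\<close>

lemma avg_balance:
  assumes u: "u \<in> topspace X" and T: "T > 0"
  shows "avg (\<lambda>v. d v \<alpha>) u T =
    lattice_div (\<lambda>\<alpha>. \<chi> j. avg (\<lambda>v. f v \<alpha> $ j) u T) \<alpha> + (e u \<alpha> - e (\<phi> u T) \<alpha>) / T"
proof -
  have int: "((\<lambda>t. f (\<phi> u t) \<beta> $ j) has_integral T * avg (\<lambda>v. f v \<beta> $ j) u T) {0..T}" for \<beta> j
    using T orbit_integrable[OF u continuous_flux] by (simp add: avg_def has_integral_iff)
  have intd: "((\<lambda>t. d (\<phi> u t) \<alpha>) has_integral T * avg (\<lambda>v. d v \<alpha>) u T) {0..T}"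
    using T orbit_integrable[OF u continuous_dissipation] by (simp add: avg_def has_integral_iff)
  have "((\<lambda>t. - d (\<phi> u t) \<alpha> + lattice_div (f (\<phi> u t)) \<alpha>) has_integral
      - (T * avg (\<lambda>v. d v \<alpha>) u T) +
      (\<Sum>j\<in>UNIV. T * avg (\<lambda>v. f v \<alpha> $ j) u T - T * avg (\<lambda>v. f v (\<alpha> - axis j 1) $ j) u T)) {0..T}"
    unfolding lattice_div_def
    by (intro has_integral_add has_integral_neg has_integral_sum has_integral_diff int intd) auto
  from has_integral_unique[OF this energy_integral[OF u less_imp_le[OF T]]]
  have "T * avg (\<lambda>v. d v \<alpha>) u T =
      T * lattice_div (\<lambda>\<alpha>. \<chi> j. avg (\<lambda>v. f v \<alpha> $ j) u T) \<alpha> + (e u \<alpha> - e (\<phi> u T) \<alpha>)"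
    by (simp add: lattice_div_def sum_distrib_left right_diff_distrib)
  then show ?thesis
    using T by (simp add: field_simps)
qed

end

section \<open>Uniform estimates for the time-averaged dissipation\<close>

context bounded_lattice_EDS
begin

text \<open>Monotonicity of \<open>b\<close> replaces its value at the energy of each state by its
  value at a common energy bound.\<close>

lemma energy_flux_constants:
  obtains E B where "E \<ge> 0" "B \<ge> 0"
    "\<And>u \<alpha>. u \<in> topspace X \<Longrightarrow> e u \<alpha> \<le> E"
    "\<And>u \<alpha> j. u \<in> topspace X \<Longrightarrow> (f u \<alpha> $ j)\<^sup>2 \<le> B * d u \<alpha>"
proof -
  obtain E0 where E0: "\<And>u. u \<in> topspace X \<Longrightarrow> linf_norm (e u) \<le> E0"
    using energy_bounded by (auto simp: bdd_above_def)
  \<comment> \<open>The maximum with 0 keeps E in the domain of \<open>b\<close> even when the space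
    is empty.\<close>
  define E where "E = max E0 0"
  obtain b where b: "mono_on {0..} b" "\<And>r. r \<ge> 0 \<Longrightarrow> b r \<ge> 0"
    "\<And>u \<alpha>. u \<in> topspace X \<Longrightarrow> (norm (f u \<alpha>))\<^sup>2 \<le> b (linf_norm (e u)) * d u \<alpha>"
    using flux_bound by auto
  show ?thesis
  proof (rule that[of E "b E"])
    show "E \<ge> 0" "b E \<ge> 0" using b(2) by (auto simp: E_def)
  next
    fix u \<alpha> j
    assume u: "u \<in> topspace X"
    have bdd: "bounded (range (e u))" using energy_linf[OF u] by (simp add: linf_def)
    show "e u \<alpha> \<le> E"
      using norm_le_linf_norm[OF bdd, of \<alpha>] E0[OF u] by (simp add: E_def)
    have "(f u \<alpha> $ j)\<^sup>2 \<le> (norm (f u \<alpha>))\<^sup>2"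
      using component_le_norm_cart[of "f u \<alpha>" j] by (simp add: abs_le_square_iff[symmetric])
    also have "\<dots> \<le> b (linf_norm (e u)) * d u \<alpha>" by (rule b(3)[OF u])
    also have "\<dots> \<le> b E * d u \<alpha>"
      using linf_norm_nonneg[OF bdd] E0[OF u] dissipation_nonneg[OF u]
      by (intro mult_right_mono mono_onD[OF b(1)]) (auto simp: E_def)
    finally show "(f u \<alpha> $ j)\<^sup>2 \<le> b E * d u \<alpha>" .
  qed
qed

text \<open>The square is convex, so the quadratic flux bound passes to averages.\<close>

lemma avg_flux_le:
  assumes u: "u \<in> topspace X" and T: "T > 0"
    and flux: "\<And>u. u \<in> topspace X \<Longrightarrow> (f u \<alpha> $ j)\<^sup>2 \<le> B * d u \<alpha>"
  shows "(avg (\<lambda>v. f v \<alpha> $ j) u T)\<^sup>2 \<le> B * avg (\<lambda>v. d v \<alpha>) u T"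
proof -
  have "(avg (\<lambda>v. f v \<alpha> $ j) u T)\<^sup>2 \<le> integral {0..T} (\<lambda>t. (f (\<phi> u t) \<alpha> $ j)\<^sup>2) / T"
    unfolding avg_def by (rule integral_power2_le[OF continuous_on_orbit_Icc[OF u continuous_flux] T])
  also have "\<dots> \<le> integral {0..T} (\<lambda>t. B * d (\<phi> u t) \<alpha>) / T"
    using T u by (intro divide_right_mono integral_le integrable_continuous_interval continuous_intros
        continuous_on_orbit_Icc[OF u] continuous_flux continuous_dissipation flux flow_in_topspace) auto
  finally show ?thesis by (simp add: avg_def)
qed

text \<open>Continuity of the dissipation norm on the compact interval \<open>[0, T]\<close> gives
  M, which depends on u and T. It serves to supply the quadratic hypothesis of
  \<open>growth_bound\<close>.\<close>

lemma avg_dissipation_bounded: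
  assumes u: "u \<in> topspace X" and T: "T > 0"
  obtains M where "\<And>\<alpha>. avg (\<lambda>v. d v \<alpha>) u T \<le> M"
proof -
  have "compact ((\<lambda>t. linf_norm (d (\<phi> u t))) ` {0..T})"
    by (intro compact_continuous_image continuous_on_subset[OF continuous_dissipation_norm[OF u]]) auto
  then have "\<exists>M. \<forall>t\<in>{0..T}. \<bar>linf_norm (d (\<phi> u t))\<bar> \<le> M"
    by (auto simp: bounded_iff dest!: compact_imp_bounded)
  then obtain M where M: "\<And>t. t \<in> {0..T} \<Longrightarrow> \<bar>linf_norm (d (\<phi> u t))\<bar> \<le> M" by blast
  have "avg (\<lambda>v. d v \<alpha>) u T \<le> M" for \<alpha>
  proof -
    have "d (\<phi> u t) \<alpha> \<le> M" if "t \<in> {0..T}" for t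
    proof -
      have "bounded (range (d (\<phi> u t)))"
        using dissipation_linf[of "\<phi> u t"] flow_in_topspace[OF u] that by (simp add: linf_def)
      from norm_le_linf_norm[OF this, of \<alpha>] M[OF that] show ?thesis by simp
    qed
    then have "integral {0..T} (\<lambda>t. d (\<phi> u t) \<alpha>) \<le> integral {0..T} (\<lambda>t. M)"
      by (intro integral_le orbit_integrable[OF u continuous_dissipation]) auto
    then show ?thesis using T by (simp add: avg_def field_simps)
  qed
  then show ?thesis using that by blast
qed

definition box_avg :: "'a \<Rightarrow> real \<Rightarrow> nat \<Rightarrow> real" where
  "box_avg u T n = (\<Sum>\<alpha>\<in>lattice_box n. avg (\<lambda>v. d v \<alpha>) u T)"

lemma box_avg_mono:
  assumes "u \<in> topspace X" "T > 0" "m \<le> n"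
  shows "box_avg u T m \<le> box_avg u T n"
  unfolding box_avg_def using assms
  by (intro sum_mono2 lattice_box_mono) (auto intro: avg_dissipation_nonneg)

lemma box_avg_nonneg: "u \<in> topspace X \<Longrightarrow> T > 0 \<Longrightarrow> 0 \<le> box_avg u T n"
  unfolding box_avg_def by (intro sum_nonneg avg_dissipation_nonneg)

text \<open>K and E are fixed before the orbit and T. The first estimate is the recursion; the
  second is its consequence through \<open>growth_bound\<close>, from which the orbit-dependent
  dissipation bound has dropped out.\<close>

lemma box_avg_estimates:
  assumes N: "CARD('n) = 1 \<or> CARD('n) = 2"
  obtains K E where "K \<ge> 0" "E \<ge> 0"
    "\<And>u T n. u \<in> topspace X \<Longrightarrow> T > 0 \<Longrightarrow> box_avg u T (Suc n) \<le>
      K * sqrt (real (Suc n) * (box_avg u T (n + 2) - box_avg u T n)) + E / T * (real (Suc n))\<^sup>2"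
    "\<And>u T n \<epsilon>. u \<in> topspace X \<Longrightarrow> T > 0 \<Longrightarrow> \<epsilon> > 0 \<Longrightarrow> box_avg u T (Suc n) \<le>
      (9 * K\<^sup>2 + 2 * (E / T) / \<epsilon>) * (real (Suc n) * (1 + \<epsilon> * real (Suc n)))"
proof -
  obtain E B where EB: "E \<ge> 0" "B \<ge> 0"
    "\<And>u \<alpha>. u \<in> topspace X \<Longrightarrow> e u \<alpha> \<le> E"
    "\<And>u \<alpha> j. u \<in> topspace X \<Longrightarrow> (f u \<alpha> $ j)\<^sup>2 \<le> B * d u \<alpha>"
    using energy_flux_constants by metis
  define K where "K = 2 * sqrt (24 * B)"
  have K: "K \<ge> 0" using EB by (simp add: K_def)
  \<comment> \<open>The box-size factor stays with the energy bound: \<open>9 * E\<close> here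
    becomes the E of the conclusion.\<close>
  have step: "box_avg u T (Suc n) \<le>
      K * sqrt (real (Suc n) * (box_avg u T (n + 2) - box_avg u T n)) + 9 * E / T * (real (Suc n))\<^sup>2"
    if u: "u \<in> topspace X" and T: "T > 0" for u T n
  proof -
    have "box_avg u T (Suc n) \<le>
        K * sqrt (real (Suc n) * (box_avg u T (n + 2) - box_avg u T n)) + 9 * (E / T) * (real (Suc n))\<^sup>2"
      unfolding box_avg_def K_def
    proof (rule sum_lattice_box_step[OF N EB(2), where F = "\<lambda>\<alpha>. \<chi> j. avg (\<lambda>v. f v \<alpha> $ j) u T"])
      fix \<alpha> j
      show "((\<chi> j. avg (\<lambda>v. f v \<alpha> $ j) u T) $ j)\<^sup>2 \<le> B * avg (\<lambda>v. d v \<alpha>) u T"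
        using avg_flux_le[OF u T EB(4)] by simp
      have "(e u \<alpha> - e (\<phi> u T) \<alpha>) / T \<le> E / T"
        using EB(3)[OF u, of \<alpha>] energy_nonneg[of "\<phi> u T" \<alpha>] flow_in_topspace[OF u, of T] T
        by (intro divide_right_mono) auto
      then show "avg (\<lambda>v. d v \<alpha>) u T \<le> lattice_div (\<lambda>\<alpha>. \<chi> j. avg (\<lambda>v. f v \<alpha> $ j) u T) \<alpha> + E / T"
        using avg_balance[OF u T, of \<alpha>] by simp
    qed (use EB T in \<open>auto intro!: avg_dissipation_nonneg u\<close>)
    then show ?thesis by simp
  qed
  have growth: "box_avg u T (Suc n) \<le>
      (9 * K\<^sup>2 + 2 * (9 * E / T) / \<epsilon>) * (real (Suc n) * (1 + \<epsilon> * real (Suc n)))"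
    if u: "u \<in> topspace X" and T: "T > 0" and \<epsilon>: "\<epsilon> > 0" for u T n \<epsilon>
  proof -
    obtain M where M: "\<And>\<alpha>. avg (\<lambda>v. d v \<alpha>) u T \<le> M"
      using avg_dissipation_bounded[OF u T] by blast
    have M0: "M \<ge> 0" using M[of 0] avg_dissipation_nonneg[OF u T, of 0] by simp
    show ?thesis
    proof (rule growth_bound[where C = "9 * M"])
      fix n
      \<comment> \<open>Dropping the inner box weakens the recursion to the form that
        \<open>growth_bound\<close> takes.\<close>
      show "box_avg u T (Suc n) \<le> K * sqrt (real (Suc n) * box_avg u T (n + 2)) + 9 * E / T * (real (Suc n))\<^sup>2"
      proof (rule order_trans[OF step[OF u T]])
        show "K * sqrt (real (Suc n) * (box_avg u T (n + 2) - box_avg u T n)) + 9 * E / T * (real (Suc n))\<^sup>2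
            \<le> K * sqrt (real (Suc n) * box_avg u T (n + 2)) + 9 * E / T * (real (Suc n))\<^sup>2"
          using box_avg_nonneg[OF u T] K
          by (intro add_right_mono mult_left_mono real_sqrt_le_mono) auto
      qed
      have "box_avg u T (Suc n) \<le> real (card (lattice_box (Suc n) :: (int ^ 'n) set)) * M"
        unfolding box_avg_def by (rule sum_bounded_above) (rule M)
      also have "\<dots> \<le> 9 * (real (Suc n))\<^sup>2 * M"
        by (intro mult_right_mono card_lattice_box_le N M0)
      finally show "box_avg u T (Suc n) \<le> 9 * M * (real (Suc n))\<^sup>2" by (simp add: mult_ac)
    qed (use K EB T \<epsilon> in \<open>auto intro!: box_avg_mono box_avg_nonneg u\<close>)
  qed
  show ?thesis
    by (rule that[OF K _ step growth]) (use EB in auto)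
qed

text \<open>Otherwise the average stays away from 0 along times tending to infinity. A subsequence
  converges at every radius; its limit obeys the recursion without error term and grows linearly, so
  \<open>riccati_sequence_eq_0\<close> makes it zero.\<close>

lemma box_avg_tendsto_0:
  assumes N: "CARD('n) = 1 \<or> CARD('n) = 2" and u: "u \<in> topspace X"
  shows "((\<lambda>T. box_avg u T m) \<longlongrightarrow> 0) at_top"
proof (rule ccontr)
  assume "\<not> ((\<lambda>T. box_avg u T m) \<longlongrightarrow> 0) at_top"
  then obtain \<eta> where \<eta>: "\<eta> > 0" and "\<not> (\<forall>\<^sub>F T in at_top. \<bar>box_avg u T m\<bar> < \<eta>)"
    by (auto simp: tendsto_iff)
  then have "\<exists>T. T > real k \<and> \<bar>box_avg u T m\<bar> \<ge> \<eta>" for k :: nat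
    by (meson eventually_at_top_dense not_le)
  then obtain \<tau> where \<tau>: "\<And>k. \<tau> k > real k" "\<And>k. \<bar>box_avg u (\<tau> k) m\<bar> \<ge> \<eta>"
    by metis
  have \<tau>_pos: "\<tau> k > 0" for k using \<tau>(1)[of k] by (meson less_le_trans not_less of_nat_0_le_iff)
  obtain K E where K: "K \<ge> 0" and E: "E \<ge> 0" and
    step: "\<And>u T n. u \<in> topspace X \<Longrightarrow> T > 0 \<Longrightarrow> box_avg u T (Suc n) \<le>
      K * sqrt (real (Suc n) * (box_avg u T (n + 2) - box_avg u T n)) + E / T * (real (Suc n))\<^sup>2" and
    growth: "\<And>u T n \<epsilon>. u \<in> topspace X \<Longrightarrow> T > 0 \<Longrightarrow> \<epsilon> > 0 \<Longrightarrow> box_avg u T (Suc n) \<le>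
      (9 * K\<^sup>2 + 2 * (E / T) / \<epsilon>) * (real (Suc n) * (1 + \<epsilon> * real (Suc n)))"
    using box_avg_estimates[OF N] by metis
  \<comment> \<open>The growth estimate with \<open>\<epsilon> = 1\<close>, made independent of T
    for T at least 1.\<close>
  define bound where "bound n = (9 * K\<^sup>2 + 2 * E) * (real (Suc n) * (1 + real (Suc n)))" for n
  have bound_pos: "bound n + 1 > 0" for n
    using E by (simp add: bound_def add_nonneg_pos)
  have bound: "box_avg u (\<tau> k) n \<le> bound n" if "k \<ge> 1" for k n
  proof -
    have "box_avg u (\<tau> k) n \<le> box_avg u (\<tau> k) (Suc n)" by (intro box_avg_mono u \<tau>_pos) simp
    also have "\<dots> \<le> (9 * K\<^sup>2 + 2 * (E / \<tau> k) / 1) * (real (Suc n) * (1 + 1 * real (Suc n)))"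
      by (intro growth u \<tau>_pos) simp
    also have "\<dots> \<le> (9 * K\<^sup>2 + 2 * E) * (real (Suc n) * (1 + real (Suc n)))"
    proof -
      have "\<tau> k \<ge> 1" using \<tau>(1)[of k] that by linarith
      then have "E / \<tau> k \<le> E" using E by (simp add: divide_le_eq mult_le_cancel_left1)
      then show ?thesis using E by (intro mult_mono) auto
    qed
    finally show ?thesis by (simp add: bound_def)
  qed
  \<comment> \<open>A diagonal extraction over all radii. Dividing by the positive number
    \<open>bound n + 1\<close> makes the family uniformly bounded by 1, and \<open>Suc\<close>
    ensures that the times are at least 1.\<close>
  obtain r where r: "strict_mono (r :: nat \<Rightarrow> nat)" and
    "\<And>n. n \<in> UNIV \<Longrightarrow> \<exists>l. (\<lambda>k. box_avg u (\<tau> (Suc (r k))) n / (bound n + 1)) \<longlonglongrightarrow> l"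
  proof (rule function_convergent_subsequence[of "UNIV :: nat set" "\<lambda>k n. box_avg u (\<tau> (Suc k)) n / (bound n + 1)" 1])
    fix k n
    show "norm (box_avg u (\<tau> (Suc k)) n / (bound n + 1)) \<le> 1"
      using bound[of "Suc k" n] bound_pos[of n] box_avg_nonneg[OF u \<tau>_pos] by simp
  qed auto
  then obtain l where l: "\<And>n. (\<lambda>k. box_avg u (\<tau> (Suc (r k))) n / (bound n + 1)) \<longlonglongrightarrow> l n"
    by (metis UNIV_I)
  define L where "L n = l n * (bound n + 1)" for n
  define t where "t k = \<tau> (Suc (r k))" for k
  have t_pos: "t k > 0" for k by (simp add: t_def \<tau>_pos)
  have L: "(\<lambda>k. box_avg u (t k) n) \<longlonglongrightarrow> L n" for n
    using tendsto_mult_right[OF l[of n], of "bound n + 1"] bound_pos[of n] by (simp add: L_def t_def)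
  have t_lim: "filterlim t at_top sequentially"
  proof (rule filterlim_at_top_mono[OF filterlim_real_sequentially])
    have "real k \<le> t k" for k
      using \<tau>(1)[of "Suc (r k)"] seq_suble[OF r, of k] by (simp add: t_def)
    then show "\<forall>\<^sub>F k in sequentially. real k \<le> t k" by simp
  qed
  have E_lim: "(\<lambda>k. E / t k) \<longlonglongrightarrow> 0"
    by (rule real_tendsto_divide_at_top[OF tendsto_const t_lim])
  have "L m = 0"
  proof (rule riccati_sequence_eq_0[OF K, where C = "9 * K\<^sup>2"])
    fix n
    show "0 \<le> L n"
      by (rule LIMSEQ_le_const[OF L]) (intro exI allI impI box_avg_nonneg u t_pos)
    show "L n \<le> L (Suc n)"
      by (rule LIMSEQ_le[OF L L]) (intro exI allI impI box_avg_mono u t_pos, simp)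
    show "L (Suc n) \<le> K * sqrt (real (Suc n) * (L (n + 2) - L n))"
    proof (rule LIMSEQ_le[OF L])
      show "(\<lambda>k. K * sqrt (real (Suc n) * (box_avg u (t k) (n + 2) - box_avg u (t k) n)) + E / t k * (real (Suc n))\<^sup>2)
          \<longlonglongrightarrow> K * sqrt (real (Suc n) * (L (n + 2) - L n))"
        by (rule tendsto_eq_intros L E_lim refl)+ simp
    qed (intro exI allI impI step u t_pos)
    show "L (Suc n) \<le> 9 * K\<^sup>2 * real (Suc n)"
    proof (rule field_le_epsilon)
      \<comment> \<open>For fixed \<open>\<epsilon>\<close> the limit in T removes the E / T term;
        only afterwards does \<open>\<epsilon>\<close> shrink, leaving linear growth.\<close>
      have bnd: "L (Suc n) \<le> 9 * K\<^sup>2 * (real (Suc n) * (1 + \<epsilon> * real (Suc n)))" if "\<epsilon> > 0" for \<epsilon>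
      proof (rule LIMSEQ_le[OF L])
        have "(\<lambda>k. 9 * K\<^sup>2 + 2 * (E / t k) / \<epsilon>) \<longlonglongrightarrow> 9 * K\<^sup>2 + 2 * 0 / \<epsilon>"
          by (intro tendsto_intros E_lim) (use that in simp)
        then show "(\<lambda>k. (9 * K\<^sup>2 + 2 * (E / t k) / \<epsilon>) * (real (Suc n) * (1 + \<epsilon> * real (Suc n))))
            \<longlonglongrightarrow> 9 * K\<^sup>2 * (real (Suc n) * (1 + \<epsilon> * real (Suc n)))"
          by (intro tendsto_mult_right) simp
      qed (intro exI allI impI growth u t_pos that)
      fix c :: real assume c: "c > 0"
      \<comment> \<open>Scaled so that the quadratic term contributes at most c; the added 1 guards
        against K = 0.\<close>
      define \<epsilon> where "\<epsilon> = c / ((9 * K\<^sup>2 + 1) * (real (Suc n))\<^sup>2)"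
      have pos: "(9 * K\<^sup>2 + 1) * (real (Suc n))\<^sup>2 > 0" by (simp add: add_nonneg_pos)
      have "9 * K\<^sup>2 * (real (Suc n) * (1 + \<epsilon> * real (Suc n))) =
          9 * K\<^sup>2 * real (Suc n) + \<epsilon> * (9 * K\<^sup>2 * (real (Suc n))\<^sup>2)"
        by (simp add: power2_eq_square algebra_simps)
      also have "\<epsilon> * (9 * K\<^sup>2 * (real (Suc n))\<^sup>2) \<le> \<epsilon> * ((9 * K\<^sup>2 + 1) * (real (Suc n))\<^sup>2)"
        using c pos by (intro mult_left_mono mult_right_mono) (auto simp: \<epsilon>_def)
      also have "\<dots> = c"
        unfolding \<epsilon>_def by (rule nonzero_eq_divide_eq[THEN iffD1, OF _ refl]) (use pos in linarith)
      finally show "L (Suc n) \<le> 9 * K\<^sup>2 * real (Suc n) + c"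
        using bnd[of \<epsilon>] c pos by (simp add: \<epsilon>_def)
    qed
  qed
  moreover have "\<eta> \<le> L m"
    by (rule LIMSEQ_le_const[OF L]) (use \<tau>(2) box_avg_nonneg[OF u \<tau>_pos] in \<open>auto simp: t_def\<close>)
  ultimately show False using \<eta> by simp
qed

lemma avg_dissipation_tendsto_0:
  assumes N: "CARD('n) = 1 \<or> CARD('n) = 2" and u: "u \<in> topspace X"
  shows "((\<lambda>T. avg (\<lambda>v. d v \<alpha>) u T) \<longlongrightarrow> 0) at_top"
proof -
  obtain n where n: "\<alpha> \<in> lattice_box n" using mem_lattice_box by blast
  have "\<forall>\<^sub>F T in at_top. norm (avg (\<lambda>v. d v \<alpha>) u T) \<le> box_avg u T n"
    using eventually_gt_at_top[of 0]
  proof eventually_elim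
    case (elim T)
    have "avg (\<lambda>v. d v \<alpha>) u T \<le> box_avg u T n"
      unfolding box_avg_def using n elim
      by (intro member_le_sum avg_dissipation_nonneg u) auto
    then show ?case using avg_dissipation_nonneg[OF u elim, of \<alpha>] by simp
  qed
  then show ?thesis
    using box_avg_tendsto_0[OF N u] by (rule Lim_null_comparison)
qed

end

section \<open>Equilibria\<close>

context bounded_lattice_EDS
begin

text \<open>Only one inclusion is an axiom. Conversely, on a constant orbit the averages of the
  dissipation equal its value, and they tend to 0.\<close>

lemma equilibria_eq:
  assumes N: "CARD('n) = 1 \<or> CARD('n) = 2"
  shows "equilibria X \<phi> = {u \<in> topspace X. \<forall>\<alpha>. d u \<alpha> = 0}"
proof (intro equalityI subsetI CollectI conjI allI)
  fix u \<alpha>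
  assume "u \<in> equilibria X \<phi>"
  then have u: "u \<in> topspace X" and stat: "\<And>t. t \<ge> 0 \<Longrightarrow> \<phi> u t = u"
    by (auto simp: equilibria_def)
  show "u \<in> topspace X" by (rule u)
  have "\<forall>\<^sub>F T in at_top. avg (\<lambda>v. d v \<alpha>) u T = d u \<alpha>"
    using eventually_gt_at_top[of 0]
  proof eventually_elim
    case (elim T)
    have "integral {0..T} (\<lambda>t. d (\<phi> u t) \<alpha>) = integral {0..T} (\<lambda>t. d u \<alpha>)"
      by (rule Henstock_Kurzweil_Integration.integral_cong) (simp add: stat)
    then show ?case using elim by (simp add: avg_def)
  qed
  then have "((\<lambda>T :: real. d u \<alpha>) \<longlongrightarrow> 0) at_top"
    by (rule Lim_transform_eventually[OF avg_dissipation_tendsto_0[OF N u], rotated])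
  then show "d u \<alpha> = 0" by (simp add: tendsto_const_iff)
qed (use stationary_if_no_dissipation in auto)

text \<open>Otherwise the box averages would stay above c, although they tend to 0.\<close>

lemma small_box_dissipation:
  assumes N: "CARD('n) = 1 \<or> CARD('n) = 2" and u: "u \<in> topspace X" and c: "c > 0"
  obtains t where "t \<ge> 0" "(\<Sum>\<alpha>\<in>lattice_box n. d (\<phi> u t) \<alpha>) < c"
proof (rule ccontr)
  assume "\<not> thesis"
  with that have large: "c \<le> (\<Sum>\<alpha>\<in>lattice_box n. d (\<phi> u t) \<alpha>)" if "t \<ge> 0" for t
    using \<open>t \<ge> 0\<close> by (meson not_le)
  have "\<forall>\<^sub>F T in at_top. c \<le> box_avg u T n"
    using eventually_gt_at_top[of 0]
  proof eventually_elim
    case (elim T)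
    have int: "((\<lambda>t. \<Sum>\<alpha>\<in>lattice_box n. d (\<phi> u t) \<alpha>) has_integral (T * box_avg u T n)) {0..T}"
      unfolding box_avg_def sum_distrib_left avg_def
      using elim orbit_integrable[OF u continuous_dissipation]
      by (intro has_integral_sum) (auto simp: has_integral_iff)
    have "((\<lambda>t. c) has_integral (T * c)) {0..T}"
      using has_integral_const_real[of c 0 T] elim by simp
    from has_integral_le[OF this int] large have "T * c \<le> T * box_avg u T n" by simp
    then show ?case using elim by simp
  qed
  from tendsto_lowerbound[OF box_avg_tendsto_0[OF N u] this] c show False by simp
qed

text \<open>At suitable late times the dissipation is small on ever larger boxes; by continuity a
  limit point of the orbit along these times dissipates at no site.\<close>

lemma omega_limit_equilibrium:
  assumes N: "CARD('n) = 1 \<or> CARD('n) = 2" and X: "compact_space X" and u: "u \<in> topspace X"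
  shows "omega_limit X \<phi> u \<inter> equilibria X \<phi> \<noteq> {}"
proof -
  have "\<exists>t\<ge>real k. (\<Sum>\<alpha>\<in>lattice_box k. d (\<phi> u t) \<alpha>) < 1 / real (Suc k)" for k
  proof -
    \<comment> \<open>Restarting the orbit at time k forces the chosen times to infinity.\<close>
    have "\<phi> u (real k) \<in> topspace X" by (intro flow_in_topspace u) simp
    then obtain t where "t \<ge> 0" "(\<Sum>\<alpha>\<in>lattice_box k. d (\<phi> (\<phi> u (real k)) t) \<alpha>) < 1 / real (Suc k)"
      by (rule small_box_dissipation[OF N, where c = "1 / real (Suc k)" and n = k]) auto
    then show ?thesis
      using flow_add[OF u, of "real k" t] by (intro exI[of _ "real k + t"]) auto
  qed
  then obtain s where s: "\<And>k. s k \<ge> real k"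
    "\<And>k. (\<Sum>\<alpha>\<in>lattice_box k. d (\<phi> u (s k)) \<alpha>) < 1 / real (Suc k)"
    by metis
  have s_nonneg: "s k \<ge> 0" for k using s(1)[of k] by (meson of_nat_0_le_iff order_trans)
  \<comment> \<open>A metric is fixed so that compactness yields convergent subsequences.\<close>
  obtain M m where m: "Metric_space M m" and X_eq: "X = Metric_space.mtopology M m"
    using metrizable by (auto simp: metrizable_space_def)
  interpret Metric_space M m by (rule m)
  have "range (\<lambda>k. \<phi> u (s k)) \<subseteq> M"
    using flow_in_topspace[OF u s_nonneg] by (auto simp: X_eq)
  then obtain x r where r: "strict_mono (r :: nat \<Rightarrow> nat)"
    and "limitin mtopology ((\<lambda>k. \<phi> u (s k)) \<circ> r) x sequentially"
    using X unfolding X_eq compact_space_sequentially by blast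
  then have lim: "limitin X (\<lambda>k. \<phi> u (s (r k))) x sequentially"
    by (simp add: X_eq o_def)
  have ge: "s (r k) \<ge> real k" for k
    using s(1)[of "r k"] seq_suble[OF r, of k] by (meson of_nat_le_iff order_trans)
  then have "filterlim (\<lambda>k. s (r k)) at_top sequentially"
    by (intro filterlim_at_top_mono[OF filterlim_real_sequentially] always_eventually) simp
  then have omega: "x \<in> omega_limit X \<phi> u"
    unfolding omega_limit_def using lim s_nonneg by (intro CollectI exI[of _ "\<lambda>k. s (r k)"]) auto
  have "d x \<alpha> = 0" for \<alpha>
  proof -
    have lim_d: "(\<lambda>k. d (\<phi> u (s (r k))) \<alpha>) \<longlonglongrightarrow> d x \<alpha>"
      using continuous_map_limit[OF continuous_dissipation[of \<alpha>] lim] by (simp add: o_def)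
    obtain n where n: "\<alpha> \<in> lattice_box n" using mem_lattice_box by blast
    \<comment> \<open>Once k reaches n, the site lies in the box of radius \<open>r k\<close>, whose
      total dissipation bounds its own.\<close>
    have "\<forall>\<^sub>F k in sequentially. d (\<phi> u (s (r k))) \<alpha> \<le> 1 / real (Suc k)"
      using eventually_ge_at_top[of n]
    proof eventually_elim
      case (elim k)
      have k: "k \<le> r k" by (rule seq_suble[OF r])
      have "\<alpha> \<in> lattice_box (r k)"
        using n lattice_box_mono[of n "r k"] elim k by auto
      then have "d (\<phi> u (s (r k))) \<alpha> \<le> (\<Sum>\<alpha>\<in>lattice_box (r k). d (\<phi> u (s (r k))) \<alpha>)"
        by (intro member_le_sum dissipation_nonneg flow_in_topspace u s_nonneg) auto
      also have "\<dots> \<le> 1 / real (Suc (r k))" using s(2)[of "r k"] by simp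
      also have "\<dots> \<le> 1 / real (Suc k)" using k by (simp add: frac_le)
      finally show ?case .
    qed
    moreover have "(\<lambda>k. 1 / real (Suc k)) \<longlonglongrightarrow> 0"
      by (rule LIMSEQ_Suc[OF lim_1_over_n])
    ultimately have "d x \<alpha> \<le> 0"
      using tendsto_le[OF sequentially_bot _ lim_d] by blast
    moreover have "d x \<alpha> \<ge> 0"
      by (rule LIMSEQ_le_const[OF lim_d]) (intro exI allI impI dissipation_nonneg flow_in_topspace u s_nonneg)
    ultimately show ?thesis by simp
  qed
  moreover have "x \<in> topspace X" using lim by (rule limitin_topspace)
  ultimately have "x \<in> equilibria X \<phi>" by (simp add: equilibria_eq[OF N])
  with omega show ?thesis by auto
qed

text \<open>The orbit is the compact, hence closed, image of one period, so it contains an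
  equilibrium of its omega-limit set. That point is met at some time r up to T and never left, yet
  the orbit is back at u at time T.\<close>

lemma no_periodic_orbit:
  assumes N: "CARD('n) = 1 \<or> CARD('n) = 2" and X: "compact_space X"
    and u: "u \<in> topspace X" and T: "T > 0" "\<phi> u T = u"
  shows "u \<in> equilibria X \<phi>"
proof -
  have period: "\<phi> u (real k * T) = u" for k
  proof (induction k)
    case (Suc k)
    have "\<phi> u (real k * T + T) = \<phi> (\<phi> u (real k * T)) T"
      using T u by (intro flow_add) auto
    then show ?case using Suc T by (simp add: algebra_simps)
  qed (simp add: flow_zero u)
  define A where "A = (\<lambda>t. \<phi> u t) ` {0..T}"
  have orbit: "\<phi> u t \<in> A" if t: "t \<ge> 0" for t
  proof -
    define k where "k = nat \<lfloor>t / T\<rfloor>"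
    have k: "real k = of_int \<lfloor>t / T\<rfloor>" using t T by (simp add: k_def)
    define r where "r = t - real k * T"
    have r: "0 \<le> r" "r \<le> T"
      using floor_divide_lower[OF T(1), of t] floor_divide_upper[OF T(1), of t]
      by (auto simp: r_def k algebra_simps)
    have "\<phi> u (real k * T + r) = \<phi> (\<phi> u (real k * T)) r"
      using T r u by (intro flow_add) auto
    then show ?thesis using r by (auto simp: A_def r_def period)
  qed
  have "compactin (top_of_set {0..}) {0..T}"
    by (auto simp: compactin_subtopology)
  then have "compactin X A"
    unfolding A_def by (rule image_compactin[OF _ continuous_map_orbit[OF u]])
  then have A: "closedin X A"
    by (intro compactin_imp_closedin metrizable_imp_Hausdorff_space metrizable)
  obtain y s where y: "y \<in> equilibria X \<phi>" and s: "\<And>n :: nat. s n \<ge> 0"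
    and lim: "limitin X (\<lambda>n. \<phi> u (s n)) y sequentially"
    using omega_limit_equilibrium[OF N X u] by (auto simp: omega_limit_def)
  have "y \<in> A"
    by (rule limitin_closedin[OF lim A]) (simp_all add: orbit s)
  then obtain r where r: "0 \<le> r" "r \<le> T" "y = \<phi> u r" by (auto simp: A_def)
  have "\<phi> u (r + (T - r)) = \<phi> y (T - r)"
    unfolding r(3) using r by (intro flow_add u) auto
  also have "\<dots> = y" using y r by (auto simp: equilibria_def)
  finally show ?thesis using y T by simp
qed

text \<open>Take an equilibrium y in the omega-limit set. Near y the flow is slow: at some time all
  the finitely many delays lead into a neighbourhood of y disjoint from the given neighbourhood of
  x, so none of them is a return.\<close>

lemma uniformly_recurrent_imp_equilibrium:
  assumes N: "CARD('n) = 1 \<or> CARD('n) = 2" and X: "compact_space X"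
    and rec: "uniformly_recurrent X \<phi> x"
  shows "x \<in> equilibria X \<phi>"
proof (rule ccontr)
  assume neq: "x \<notin> equilibria X \<phi>"
  have x: "x \<in> topspace X" using rec by (simp add: uniformly_recurrent_def)
  obtain y s where y: "y \<in> equilibria X \<phi>" and s: "\<And>n :: nat. s n \<ge> 0"
    and lim: "limitin X (\<lambda>n. \<phi> x (s n)) y sequentially"
    using omega_limit_equilibrium[OF N X x] by (auto simp: omega_limit_def)
  have yX: "y \<in> topspace X" and y_stat: "\<And>t. t \<ge> 0 \<Longrightarrow> \<phi> y t = y"
    using y by (auto simp: equilibria_def)
  have "x \<noteq> y" using neq y by auto
  then obtain U V where UV: "openin X U" "openin X V" "x \<in> U" "y \<in> V" "disjnt U V"
    using metrizable_imp_Hausdorff_space[OF metrizable] x yX unfolding Hausdorff_space_def by metis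
  have "\<forall>U. openin X U \<and> x \<in> U \<longrightarrow> (\<exists>n\<ge>1. \<exists>\<tau> :: nat \<Rightarrow> real.
      (\<forall>k\<in>{1..n}. \<tau> k \<ge> 0) \<and> (\<forall>t\<ge>0. \<exists>k\<in>{1..n}. \<phi> x (t + \<tau> k) \<in> U))"
    using rec unfolding uniformly_recurrent_def by (rule conjunct2)
  from this[rule_format, OF conjI[OF UV(1,3)]] obtain n and \<tau> :: "nat \<Rightarrow> real"
    where "\<forall>k\<in>{1..n}. \<tau> k \<ge> 0" "\<forall>t\<ge>0. \<exists>k\<in>{1..n}. \<phi> x (t + \<tau> k) \<in> U"
    by (elim exE conjE)
  then have \<tau>: "\<And>k. k \<in> {1..n} \<Longrightarrow> \<tau> k \<ge> 0"
    and ret: "\<And>t. t \<ge> 0 \<Longrightarrow> \<exists>k\<in>{1..n}. \<phi> x (t + \<tau> k) \<in> U"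
    by blast+
  \<comment> \<open>Continuity of the map at time \<open>\<tau> k\<close>, which fixes y.\<close>
  have "\<forall>\<^sub>F i in sequentially. \<phi> x (s i + \<tau> k) \<in> V" if k: "k \<in> {1..n}" for k
  proof -
    have "limitin X ((\<lambda>v. \<phi> v (\<tau> k)) \<circ> (\<lambda>n. \<phi> x (s n))) (\<phi> y (\<tau> k)) sequentially"
      by (rule continuous_map_limit[OF continuous_map_flow[OF \<tau>[OF k]] lim])
    then have "\<forall>\<^sub>F i in sequentially. \<phi> (\<phi> x (s i)) (\<tau> k) \<in> V"
      using UV y_stat[OF \<tau>[OF k]] by (auto simp: limitin_def)
    then show ?thesis
      by eventually_elim (simp add: flow_add[OF x s \<tau>[OF k]])
  qed
  then have "\<forall>\<^sub>F i in sequentially. \<forall>k\<in>{1..n}. \<phi> x (s i + \<tau> k) \<in> V"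
    by (intro eventually_ball_finite) auto
  then have "\<exists>i. \<forall>k\<in>{1..n}. \<phi> x (s i + \<tau> k) \<in> V"
    by (rule eventually_happens'[OF sequentially_bot])
  then obtain i where "\<forall>k\<in>{1..n}. \<phi> x (s i + \<tau> k) \<in> V"
    by blast
  with ret[OF s[of i]] UV(5) show False unfolding disjnt_iff by blast
qed

text \<open>Being closed and invariant, A contains the omega-limit sets of its points, hence an
  equilibrium, whose singleton is already closed and positively invariant.\<close>

lemma minimal_imp_equilibrium:
  assumes N: "CARD('n) = 1 \<or> CARD('n) = 2" and X: "compact_space X"
    and A: "minimal_closed_positively_invariant X \<phi> A"
  shows "\<exists>x\<in>equilibria X \<phi>. A = {x}"
proof -
  have closed: "closedin X A" and inv: "\<And>t u. t \<ge> 0 \<Longrightarrow> u \<in> A \<Longrightarrow> \<phi> u t \<in> A"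
    using A by (auto simp: minimal_closed_positively_invariant_def closed_positively_invariant_def)
  have minimal: "B = A" if "B \<noteq> {}" "B \<subseteq> A" "closed_positively_invariant X \<phi> B" for B
    using A that unfolding minimal_closed_positively_invariant_def psubset_eq by blast
  obtain u where u: "u \<in> A" "u \<in> topspace X"
    using A closedin_subset[OF closed] by (auto simp: minimal_closed_positively_invariant_def)
  obtain x s where x: "x \<in> equilibria X \<phi>" and s: "\<And>n :: nat. s n \<ge> 0"
    and lim: "limitin X (\<lambda>n. \<phi> u (s n)) x sequentially"
    using omega_limit_equilibrium[OF N X u(2)] by (auto simp: omega_limit_def)
  have "x \<in> A"
    by (rule limitin_closedin[OF lim closed]) (simp_all add: inv s u)
  have "closedin X {x}"
    using metrizable_imp_t1_space[OF metrizable] x by (auto simp: t1_space_closedin_singleton equilibria_def)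
  then have "closed_positively_invariant X \<phi> {x}"
    using x by (auto simp: closed_positively_invariant_def equilibria_def)
  then have "{x} = A" using \<open>x \<in> A\<close> by (intro minimal) auto
  then show ?thesis using x by auto
qed

end

section \<open>Invariant measures\<close>

text \<open>A discretisation of time by countably many values, used for joint measurability.\<close>

lemma floor_approx_tendsto: "(\<lambda>n. real_of_int \<lfloor>real (Suc n) * t\<rfloor> / real (Suc n)) \<longlonglongrightarrow> t"
proof -
  have "(\<lambda>n. real_of_int \<lfloor>real (Suc n) * t\<rfloor> / real (Suc n) - t) \<longlonglongrightarrow> 0"
  proof (rule Lim_null_comparison)
    show "\<forall>\<^sub>F n in sequentially. norm (real_of_int \<lfloor>real (Suc n) * t\<rfloor> / real (Suc n) - t) \<le> 1 / real (Suc n)"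
    proof (intro always_eventually allI)
      fix n
      have "real_of_int \<lfloor>real (Suc n) * t\<rfloor> / real (Suc n) - t =
          (real_of_int \<lfloor>real (Suc n) * t\<rfloor> - real (Suc n) * t) / real (Suc n)"
        by (simp add: diff_divide_distrib)
      also have "norm \<dots> = \<bar>real_of_int \<lfloor>real (Suc n) * t\<rfloor> - real (Suc n) * t\<bar> / real (Suc n)"
        by (simp only: real_norm_def abs_divide abs_of_nat)
      also have "\<dots> \<le> 1 / real (Suc n)"
        by (intro divide_right_mono) linarith+
      finally show "norm (real_of_int \<lfloor>real (Suc n) * t\<rfloor> / real (Suc n) - t) \<le> 1 / real (Suc n)" .
    qed
    show "(\<lambda>n. 1 / real (Suc n)) \<longlonglongrightarrow> 0" by (rule LIMSEQ_Suc[OF lim_1_over_n])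
  qed
  then show ?thesis by (rule LIM_zero_cancel)
qed

lemma continuous_map_borel_measurable:
  fixes g :: "'a \<Rightarrow> real"
  assumes "continuous_map X euclideanreal g"
    and "space \<mu> = topspace X" "sets \<mu> = sigma_sets (topspace X) {U. openin X U}"
  shows "g \<in> borel_measurable \<mu>"
proof (rule borel_measurableI)
  fix S :: "real set" assume "open S"
  then have "openin X {x \<in> topspace X. g x \<in> S}"
    using assms(1) by (simp add: continuous_map_def)
  moreover have "g -` S \<inter> space \<mu> = {x \<in> topspace X. g x \<in> S}" using assms(2) by auto
  ultimately show "g -` S \<inter> space \<mu> \<in> sets \<mu>"
    unfolding assms(3) by (auto intro: sigma_sets.Basic)
qed

lemma compact_space_bounded_function:
  assumes "compact_space X" "continuous_map X euclideanreal g"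
  obtains C where "\<And>u. u \<in> topspace X \<Longrightarrow> \<bar>g u\<bar> \<le> C"
proof -
  have "compact (g ` topspace X)"
    using image_compactin[OF _ assms(2), of "topspace X"] assms(1) by (simp add: compact_space_def)
  then have "\<exists>C. \<forall>u\<in>topspace X. \<bar>g u\<bar> \<le> C"
    by (auto simp: bounded_iff dest!: compact_imp_bounded)
  then show ?thesis using that by blast
qed

section \<open>Measurability of the flow and invariance of integrals\<close>

context semiflow
begin

text \<open>Joint continuity refers to the product topology, not to the product sigma-algebra. So
  time is approximated by countably many values, for each of which the map is measurable in u, and
  continuity along orbits gives the limit.\<close>

lemma flow_measurable_jointly:
  assumes g: "continuous_map X euclideanreal g"
    and \<mu>: "space \<mu> = topspace X" "sets \<mu> = sigma_sets (topspace X) {U. openin X U}"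
  shows "(\<lambda>(t, u). g (\<phi> u t)) \<in> borel_measurable (restrict_space lborel {0..T} \<Otimes>\<^sub>M \<mu>)"
proof (rule borel_measurable_LIMSEQ_real)
  let ?N = "restrict_space lborel {0..T} \<Otimes>\<^sub>M \<mu>"
  let ?t = "\<lambda>n t. real_of_int \<lfloor>real (Suc n) * t\<rfloor> / real (Suc n)"
  have meas: "(\<lambda>u. g (\<phi> u t)) \<in> borel_measurable \<mu>" if "t \<ge> 0" for t
    using continuous_map_compose[OF continuous_map_flow[OF that] g]
    by (intro continuous_map_borel_measurable[OF _ \<mu>]) (simp add: o_def)
  \<comment> \<open>The \<open>max 0\<close> changes nothing on the time interval, but makes the
    slice for every integer a flow at nonnegative time.\<close>
  show "(\<lambda>x. case x of (t, u) \<Rightarrow> g (\<phi> u (max 0 (?t n t)))) \<in> borel_measurable ?N" for n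
  proof -
    have "(\<lambda>x. \<lfloor>real (Suc n) * fst x\<rfloor>) \<in> measurable ?N (count_space UNIV)"
    proof -
      have "(\<lambda>x. x) \<in> measurable (restrict_space lborel {0..T}) borel"
        by (intro measurable_restrict_space1) simp
      then have "fst \<in> borel_measurable ?N"
        using measurable_compose[OF measurable_fst] by blast
      then show ?thesis by measurable
    qed
    moreover have "(\<lambda>x. g (\<phi> (snd x) (max 0 (real_of_int i / real (Suc n))))) \<in> borel_measurable ?N" for i :: int
      by (rule measurable_compose[OF measurable_snd meas]) simp
    ultimately have "(\<lambda>x. g (\<phi> (snd x) (max 0 (real_of_int \<lfloor>real (Suc n) * fst x\<rfloor> / real (Suc n)))))
        \<in> borel_measurable ?N"
      by (rule measurable_compose_countable[rotated])
    then show ?thesis by (simp add: case_prod_unfold)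
  qed
  fix x assume x: "x \<in> space ?N"
  obtain t u where tu: "x = (t, u)" by (cases x)
  have t: "t \<ge> 0" and u: "u \<in> topspace X"
    using x \<mu> by (auto simp: tu space_pair_measure space_restrict_space)
  have "?t n t \<ge> 0" for n using t by simp
  then have "(\<lambda>n. g (\<phi> u (?t n t))) \<longlonglongrightarrow> g (\<phi> u t)"
    using continuous_on_orbit[OF u g] t
    by (intro continuous_on_tendsto_compose[OF _ floor_approx_tendsto]) auto
  then show "(\<lambda>n. case x of (t, u) \<Rightarrow> g (\<phi> u (max 0 (?t n t)))) \<longlonglongrightarrow> (case x of (t, u) \<Rightarrow> g (\<phi> u t))"
    using \<open>\<And>n. ?t n t \<ge> 0\<close> by (simp add: tu max_def)
qed

text \<open>Invariance on sets says that the push-forward under the time-t map is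
  \<open>\<mu>\<close> itself; the rest is a change of variables.\<close>

lemma invariant_integral:
  assumes \<mu>: "invariant_borel_prob X \<phi> \<mu>" and g: "continuous_map X euclideanreal g" and t: "t \<ge> 0"
  shows "(\<integral>u. g (\<phi> u t) \<partial>\<mu>) = (\<integral>u. g u \<partial>\<mu>)"
proof -
  have sp: "space \<mu> = topspace X" and st: "sets \<mu> = sigma_sets (topspace X) {U. openin X U}"
    and inv: "\<And>A. A \<in> sets \<mu> \<Longrightarrow> emeasure \<mu> {u \<in> topspace X. \<phi> u t \<in> A} = emeasure \<mu> A"
    using \<mu> t by (auto simp: invariant_borel_prob_def)
  have meas: "(\<lambda>u. \<phi> u t) \<in> measurable \<mu> \<mu>"
  proof (rule measurable_sigma_sets[OF st])
    show "{U. openin X U} \<subseteq> Pow (topspace X)" using openin_subset by auto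
    show "(\<lambda>u. \<phi> u t) \<in> space \<mu> \<rightarrow> topspace X" using flow_in_topspace t by (auto simp: sp)
    fix U assume "U \<in> {U. openin X U}"
    then have "openin X {u \<in> topspace X. \<phi> u t \<in> U}"
      using continuous_map_flow[OF t] by (simp add: continuous_map_def)
    moreover have "(\<lambda>u. \<phi> u t) -` U \<inter> space \<mu> = {u \<in> topspace X. \<phi> u t \<in> U}" by (auto simp: sp)
    ultimately show "(\<lambda>u. \<phi> u t) -` U \<inter> space \<mu> \<in> sets \<mu>"
      by (auto simp: st intro: sigma_sets.Basic)
  qed
  have "distr \<mu> \<mu> (\<lambda>u. \<phi> u t) = \<mu>"
  proof (rule measure_eqI)
    fix A assume "A \<in> sets (distr \<mu> \<mu> (\<lambda>u. \<phi> u t))"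
    then have A: "A \<in> sets \<mu>" by simp
    have "(\<lambda>u. \<phi> u t) -` A \<inter> space \<mu> = {u \<in> topspace X. \<phi> u t \<in> A}" by (auto simp: sp)
    then show "emeasure (distr \<mu> \<mu> (\<lambda>u. \<phi> u t)) A = emeasure \<mu> A"
      using inv[OF A] by (simp add: emeasure_distr[OF meas A])
  qed simp
  then show ?thesis
    using integral_distr[OF meas continuous_map_borel_measurable[OF g sp st]] by simp
qed

end

context bounded_lattice_EDS
begin

lemma abs_avg_le:
  assumes u: "u \<in> topspace X" and g: "continuous_map X euclideanreal g" and T: "T > 0"
    and C: "\<And>u. u \<in> topspace X \<Longrightarrow> \<bar>g u\<bar> \<le> C"
  shows "\<bar>avg g u T\<bar> \<le> C"
proof -
  have "norm (integral {0..T} (\<lambda>t. g (\<phi> u t))) \<le> integral {0..T} (\<lambda>t. C)"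
    by (intro integral_norm_bound_integral orbit_integrable u g) (auto intro!: C flow_in_topspace u)
  then show ?thesis using T by (simp add: avg_def divide_le_eq mult.commute)
qed

text \<open>Fubini on \<open>[0, T]\<close> times X, followed by invariance at each time.
  Compactness bounds g, which makes the integrand integrable.\<close>

lemma invariant_integral_avg:
  assumes X: "compact_space X" and \<mu>: "invariant_borel_prob X \<phi> \<mu>"
    and g: "continuous_map X euclideanreal g" and T: "T > 0"
  shows "(\<lambda>u. avg g u T) \<in> borel_measurable \<mu>"
    and "(\<integral>u. avg g u T \<partial>\<mu>) = (\<integral>u. g u \<partial>\<mu>)"
proof -
  have sp: "space \<mu> = topspace X" and st: "sets \<mu> = sigma_sets (topspace X) {U. openin X U}"
    and "prob_space \<mu>"
    using \<mu> by (auto simp: invariant_borel_prob_def)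
  define \<nu> where "\<nu> = restrict_space lborel {0..T}"
  interpret \<mu>: prob_space \<mu> by fact
  interpret \<nu>: finite_measure \<nu>
    by (rule finite_measureI) (use T in \<open>simp add: \<nu>_def space_restrict_space emeasure_restrict_space\<close>)
  interpret pair_sigma_finite \<nu> \<mu> ..
  interpret pair: finite_measure "\<nu> \<Otimes>\<^sub>M \<mu>"
    by (rule finite_measure_pair_measure) unfold_locales
  obtain C where C: "\<And>u. u \<in> topspace X \<Longrightarrow> \<bar>g u\<bar> \<le> C"
    using compact_space_bounded_function[OF X g] by blast
  have int: "integrable (\<nu> \<Otimes>\<^sub>M \<mu>) (\<lambda>(t, u). g (\<phi> u t))"
  proof (rule pair.integrable_const_bound[where B = C])
    show "AE x in \<nu> \<Otimes>\<^sub>M \<mu>. norm (case x of (t, u) \<Rightarrow> g (\<phi> u t)) \<le> C"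
      by (rule AE_I2)
        (auto simp: space_pair_measure sp \<nu>_def space_restrict_space intro!: C flow_in_topspace)
  qed (use flow_measurable_jointly[OF g sp st, of T] in \<open>simp add: \<nu>_def\<close>)
  have inner: "(\<integral>t. g (\<phi> u t) \<partial>\<nu>) = T * avg g u T" if u: "u \<in> space \<mu>" for u
  proof -
    have "(\<integral>t. g (\<phi> u t) \<partial>\<nu>) = (LINT t:{0..T}|lborel. g (\<phi> u t))"
      unfolding \<nu>_def set_lebesgue_integral_def by (rule integral_restrict_space) simp
    also have "\<dots> = integral {0..T} (\<lambda>t. g (\<phi> u t))"
      using u sp by (intro set_borel_integral_eq_integral borel_integrable_atLeastAtMost'
          continuous_on_orbit_Icc g) simp
    finally show ?thesis using T by (simp add: avg_def)
  qed
  have "integrable \<mu> (\<lambda>u. T * avg g u T)"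
    using integrable_snd[OF int] inner by (simp cong: Bochner_Integration.integrable_cong)
  then have "integrable \<mu> (\<lambda>u. (1 / T) * (T * avg g u T))" by (rule integrable_mult_right)
  then show "(\<lambda>u. avg g u T) \<in> borel_measurable \<mu>" using T by simp
  have "T * (\<integral>u. avg g u T \<partial>\<mu>) = (\<integral>u. (\<integral>t. g (\<phi> u t) \<partial>\<nu>) \<partial>\<mu>)"
    using inner by (simp cong: Bochner_Integration.integral_cong)
  also have "\<dots> = (\<integral>t. (\<integral>u. g (\<phi> u t) \<partial>\<mu>) \<partial>\<nu>)"
    by (rule Fubini_integral[OF int])
  also have "\<dots> = (\<integral>t. (\<integral>u. g u \<partial>\<mu>) \<partial>\<nu>)"
    by (intro Bochner_Integration.integral_cong invariant_integral[OF \<mu> g])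
      (auto simp: \<nu>_def space_restrict_space)
  also have "\<dots> = T * (\<integral>u. g u \<partial>\<mu>)"
    using T by (simp add: \<nu>_def space_restrict_space measure_restrict_space)
  finally show "(\<integral>u. avg g u T \<partial>\<mu>) = (\<integral>u. g u \<partial>\<mu>)" using T by simp
qed

text \<open>At each site the integral of the dissipation equals that of its averages, which tend to
  0 pointwise and are dominated by a constant. Being nonnegative, the dissipation vanishes almost
  everywhere.\<close>

lemma invariant_measure_equilibria:
  assumes N: "CARD('n) = 1 \<or> CARD('n) = 2" and X: "compact_space X"
    and \<mu>: "invariant_borel_prob X \<phi> \<mu>"
  shows "measure \<mu> (equilibria X \<phi>) = 1"
proof -
  have sp: "space \<mu> = topspace X" and st: "sets \<mu> = sigma_sets (topspace X) {U. openin X U}"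
    and "prob_space \<mu>"
    using \<mu> by (auto simp: invariant_borel_prob_def)
  interpret prob_space \<mu> by fact
  have d_meas [measurable]: "(\<lambda>u. d u \<alpha>) \<in> borel_measurable \<mu>" for \<alpha>
    by (rule continuous_map_borel_measurable[OF continuous_dissipation sp st])
  have "AE u in \<mu>. d u \<alpha> = 0" for \<alpha>
  proof -
    obtain C where C: "\<And>u. u \<in> topspace X \<Longrightarrow> \<bar>d u \<alpha>\<bar> \<le> C"
      using compact_space_bounded_function[OF X continuous_dissipation] by blast
    have "(\<lambda>k. \<integral>u. avg (\<lambda>v. d v \<alpha>) u (real (Suc k)) \<partial>\<mu>) \<longlonglongrightarrow> (\<integral>u. 0 \<partial>\<mu>)"
    proof (rule integral_dominated_convergence[where w = "\<lambda>_. C"])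
      show "(\<lambda>u. avg (\<lambda>v. d v \<alpha>) u (real (Suc k))) \<in> borel_measurable \<mu>" for k
        by (rule invariant_integral_avg(1)[OF X \<mu> continuous_dissipation]) simp
      show "AE u in \<mu>. (\<lambda>k. avg (\<lambda>v. d v \<alpha>) u (real (Suc k))) \<longlonglongrightarrow> 0"
      proof (rule AE_I2)
        fix u assume "u \<in> space \<mu>"
        then have u: "u \<in> topspace X" by (simp add: sp)
        show "(\<lambda>k. avg (\<lambda>v. d v \<alpha>) u (real (Suc k))) \<longlonglongrightarrow> 0"
          by (rule LIMSEQ_Suc)
            (rule filterlim_compose[OF avg_dissipation_tendsto_0[OF N u] filterlim_real_sequentially])
      qed
      show "AE u in \<mu>. norm (avg (\<lambda>v. d v \<alpha>) u (real (Suc k))) \<le> C" for k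
        unfolding real_norm_def
        by (intro AE_I2 abs_avg_le continuous_dissipation C) (simp_all add: sp)
    qed auto
    moreover have "(\<integral>u. avg (\<lambda>v. d v \<alpha>) u (real (Suc k)) \<partial>\<mu>) = (\<integral>u. d u \<alpha> \<partial>\<mu>)" for k
      by (rule invariant_integral_avg(2)[OF X \<mu> continuous_dissipation]) simp
    ultimately have "(\<integral>u. d u \<alpha> \<partial>\<mu>) = 0"
      by (simp add: LIMSEQ_const_iff)
    moreover have "integrable \<mu> (\<lambda>u. d u \<alpha>)"
      by (rule integrable_const_bound[where B = C]) (use C sp in \<open>auto intro!: AE_I2\<close>)
    ultimately show ?thesis
      using dissipation_nonneg sp by (subst (asm) integral_nonneg_eq_0_iff_AE) (auto intro!: AE_I2)
  qed
  \<comment> \<open>The lattice is countable, so the null sets of the individual sites combine into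
    one.\<close>
  then have AE: "AE u in \<mu>. \<forall>\<alpha>. d u \<alpha> = 0"
    by (simp add: AE_all_countable)
  have eq: "equilibria X \<phi> = {u \<in> space \<mu>. \<forall>\<alpha>. d u \<alpha> = 0}"
    by (simp add: equilibria_eq[OF N] sp)
  have "{u \<in> space \<mu>. \<forall>\<alpha>. d u \<alpha> = 0} \<in> sets \<mu>"
    by measurable
  then show ?thesis
    unfolding eq using AE by (simp add: prob_Collect_eq_1)
qed

end

theorem theorem4:
  fixes X :: "'a topology" and \<phi> :: "'a \<Rightarrow> real \<Rightarrow> 'a"
    and e :: "'a \<Rightarrow> int ^ 'n::finite \<Rightarrow> real"
    and d :: "'a \<Rightarrow> int ^ 'n \<Rightarrow> real"
    and f :: "'a \<Rightarrow> int ^ 'n \<Rightarrow> real ^ 'n"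
  assumes "bounded_lattice_EDS X \<phi> e d f"
    and "CARD('n) = 1 \<or> CARD('n) = 2"
    and "compact_space X"
  shows "(\<not> (\<exists>u\<in>topspace X. u \<notin> equilibria X \<phi> \<and> (\<exists>T>0. \<phi> u T = u))) \<and>
    (\<forall>u\<in>topspace X. omega_limit X \<phi> u \<inter> equilibria X \<phi> \<noteq> {}) \<and>
    (\<forall>x. uniformly_recurrent X \<phi> x \<longrightarrow> x \<in> equilibria X \<phi>) \<and>
    (\<forall>A. minimal_closed_positively_invariant X \<phi> A \<longrightarrow> (\<exists>x\<in>equilibria X \<phi>. A = {x})) \<and>
    (\<forall>\<mu>. invariant_borel_prob X \<phi> \<mu> \<longrightarrow> measure \<mu> (equilibria X \<phi>) = 1)"
proof -
  interpret bounded_lattice_EDS X \<phi> e d f by fact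
  note N = assms(2) and X = assms(3)
  show ?thesis
    using no_periodic_orbit[OF N X] omega_limit_equilibrium[OF N X]
      uniformly_recurrent_imp_equilibrium[OF N X] minimal_imp_equilibrium[OF N X]
      invariant_measure_equilibria[OF N X]
    by blast
qed

end
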